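(* The contravariant functors $\mathscr{A}_F=\langle\mathscr{A}_0,\mathscr{A}_1\rangle\colon\mathbb{OMS}\to\mathbb{OML}$ and $\mathscr{S}_F=\langle\mathscr{S}_0,\mathscr{S}_1\rangle\colon\mathbb{OML}\to\mathbb{OMS}$ constitute a dual equivalence of categories.
   Context: An ortholattice is an algebra $\langle A;\cdot,-,0\rangle$ such that $\langle A;\cdot,0\rangle$ is a meet-semilattice with least element $0$ and $-$ satisfies $a\cdot -a=0$, $a\le b\Rightarrow -b\le -a$, $a=--a$; joins are $a+b:=-(-a\cdot -b)$. An orthomodular lattice is an ortholattice satisfying $a\le b\Rightarrow b=a+(-a\cdot b)$. $\mathbb{OML}$ is the category of orthomodular lattices and homomorphisms preserving $\cdot$, $-$, $0$. An orthomodular frame is a structure $\langle X;\preceq,\perp,\Omega\rangle$ with $\preceq,\perp\subseteq X\times X$ and $\Omega\subseteq X$ such that: (1) $\langle X;\preceq\rangle$ is a partially ordered meet-semilattice (write $x\cap y:=\inf\{x,y\}$ and ${\uparrow}x=\{y:x\preceq y\}$); (2) it has a top element $\omega$ with $\omega\in\Omega$; (3) for every $x\in\Omega$ there is $z\in\Omega$ such that for all $y$, $x\perp y\Leftrightarrow z\preceq y$, and for all $u$, $z\perp u\Rightarrow x\preceq u$; (4) for all $x,y\in\Omega$: if $y\preceq x$ and for all $z$ ($y\preceq z$ and $z\perp x$ imply $z=\omega$), then $x=y$; (5) $x\perp x\Rightarrow x=\omega$; (6) $x,y\in\Omega\Rightarrow x\cap y\in\Omega$; (7) $x\perp\omega$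 for all $x$; (8) $x\perp y\Rightarrow y\perp x$; (9) if $x\perp y$ and $x\preceq z$ then $z\perp y$. For $U\subseteq X$, $U^{\perp}:=\{x: x\perp y\ \forall y\in U\}$; $U$ is $\perp$-stable if $U=U^{\perp\perp}$; $\mathcal{CO}(\mathcal{X})^{\dagger}$ is the set of clopen $\perp$-stable subsets. An orthomodular space is $\mathcal{X}=\langle X;\preceq,\perp,\Omega,\mathcal{T}_X\rangle$ with: (1) its frame reduct an orthomodular frame; (2) compact topology; (3) $\mathcal{CO}(\mathcal{X})^{\dagger}$ closed under $\cap$ and ${}^{\perp}$; (4) each $U\in\mathcal{CO}(\mathcal{X})^{\dagger}$ equals ${\uparrow}z$ for some $z\in\Omega$; (5) if $x\not\preceq y$ some $U\in\mathcal{CO}(\mathcal{X})^{\dagger}$ has $x\in U$, $y\notin U$; (6) if $x\perp y$ some $U\in\mathcal{CO}(\mathcal{X})^{\dagger}$ has $x\in U$, $y\in U^{\perp}$. A continuous weak $p$-morphism $\psi\colon\mathcal{X}\to\mathcal{X}'$ is a continuous function such that (1) $x\not\perp_X y\Rightarrow\psi(x)\not\perp_{X'}\psi(y)$, and (2) if $z'\not\perp_{X'}\psi(y)$ then there is $x$ with $x\not\perp_X y$ and $z'\preceq_{X'}\psi(x)$. $\mathbb{OMS}$ is the category of orthomodular spaces and continuous weak $p$-morphisms. Functors: for an orthomodular lattice $\mathfrak{A}$, a filter is a nonempty upward-closed subset closed under binary meets (the improper filter $A$ allowed); $\mathfrak{F}(\mathfrak{A})$ is the set of filters, $\mathfrak{P}(\mathfrak{A})$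 the principal filters; $x\perp_A y$ iff some $a\in x$ has $-a\in y$; with $h(a)=\{x\in\mathfrak{F}(\mathfrak{A}):a\in x\}$, $\mathscr{S}_0(\mathfrak{A})=\langle\mathfrak{F}(\mathfrak{A});\subseteq,\perp_A,\mathfrak{P}(\mathfrak{A}),\mathcal{T}\rangle$ with $\mathcal{T}$ generated by the subbasis $\{h(a)\}_{a\in A}\cup\{\mathfrak{F}(\mathfrak{A})\setminus h(a)\}_{a\in A}$; for a homomorphism $\phi\colon\mathfrak{A}\to\mathfrak{A}'$, $\mathscr{S}_1(\phi)\colon\mathscr{S}_0(\mathfrak{A}')\to\mathscr{S}_0(\mathfrak{A})$ is $x\mapsto\phi^{-1}[x]$. For an orthomodular space $\mathcal{X}$ with top $\omega$, $\mathscr{A}_0(\mathcal{X})=\langle\mathcal{CO}(\mathcal{X})^{\dagger};\cap,{}^{\perp},\{\omega\}\rangle$, and for a continuous weak $p$-morphism $\psi\colon\mathcal{X}\to\mathcal{X}'$, $\mathscr{A}_1(\psi)\colon\mathscr{A}_0(\mathcal{X}')\to\mathscr{A}_0(\mathcal{X})$ is $U\mapsto\psi^{-1}[U]$. *)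

theory Defs
  imports "HOL-Analysis.Analysis"
begin

section \<open>Orthomodular lattices\<close>

text \<open>The algebras here live on explicit carriers, because the dual algebra of a space is carried
  by a set of subsets; the type class of orthomodular lattices in HOL-Library cannot be used for
  that.\<close>

record 'a ortho_alg =
  carr :: "'a set"
  mt :: "'a \<Rightarrow> 'a \<Rightarrow> 'a"  (infixl "\<cdot>\<index>" 70)
  cmpl :: "'a \<Rightarrow> 'a"  ("\<sim>\<index> _" [81] 80)
  zer :: "'a"  ("\<zero>\<index>")

definition alg_le :: "('a, 'm) ortho_alg_scheme \<Rightarrow> 'a \<Rightarrow> 'a \<Rightarrow> bool"  (infix "\<sqsubseteq>\<index>" 50)
  where "a \<sqsubseteq>\<^bsub>L\<^esub> b \<longleftrightarrow> a \<cdot>\<^bsub>L\<^esub> b = a"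

definition alg_join :: "('a, 'm) ortho_alg_scheme \<Rightarrow> 'a \<Rightarrow> 'a \<Rightarrow> 'a"  (infixl "\<squnion>\<index>" 65)
  where "a \<squnion>\<^bsub>L\<^esub> b = \<sim>\<^bsub>L\<^esub> (\<sim>\<^bsub>L\<^esub> a \<cdot>\<^bsub>L\<^esub> \<sim>\<^bsub>L\<^esub> b)"

locale ortholattice =
  fixes L (structure)
  assumes meet_closed: "\<lbrakk>a \<in> carr L; b \<in> carr L\<rbrakk> \<Longrightarrow> a \<cdot> b \<in> carr L"
    and compl_closed: "a \<in> carr L \<Longrightarrow> \<sim> a \<in> carr L"
    and zero_closed: "\<zero> \<in> carr L"
    and meet_assoc: "\<lbrakk>a \<in> carr L; b \<in> carr L; c \<in> carr L\<rbrakk> \<Longrightarrow> (a \<cdot> b) \<cdot> c = a \<cdot> (b \<cdot> c)"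
    and meet_comm: "\<lbrakk>a \<in> carr L; b \<in> carr L\<rbrakk> \<Longrightarrow> a \<cdot> b = b \<cdot> a"
    and meet_idem: "a \<in> carr L \<Longrightarrow> a \<cdot> a = a"
    and zero_least: "a \<in> carr L \<Longrightarrow> \<zero> \<sqsubseteq> a"
    and meet_compl: "a \<in> carr L \<Longrightarrow> a \<cdot> \<sim> a = \<zero>"
    and compl_antitone: "\<lbrakk>a \<in> carr L; b \<in> carr L; a \<sqsubseteq> b\<rbrakk> \<Longrightarrow> \<sim> b \<sqsubseteq> \<sim> a"
    and compl_compl: "a \<in> carr L \<Longrightarrow> a = \<sim> (\<sim> a)"

locale orthomodular_lattice = ortholattice +
  assumes orthomodular: "\<lbrakk>a \<in> carr L; b \<in> carr L; a \<sqsubseteq> b\<rbrakk> \<Longrightarrow> b = a \<squnion> (\<sim> a \<cdot> b)"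

text \<open>Morphisms of both categories are extensional functions on the carrier of their domain, so that
  HOL equality of morphisms is equality of arrows. Identities are \<open>\<lambda>x\<in>A. x\<close> and composition is
  \<^const>\<open>compose\<close>; the unit and associativity laws are \<open>Id_compose\<close>, \<open>compose_Id\<close> and
  \<open>compose_assoc\<close>.\<close>

definition oml_hom :: "'a ortho_alg \<Rightarrow> 'b ortho_alg \<Rightarrow> ('a \<Rightarrow> 'b) set" where
  "oml_hom A B = {\<phi> \<in> carr A \<rightarrow>\<^sub>E carr B.
     (\<forall>a\<in>carr A. \<forall>b\<in>carr A. \<phi> (a \<cdot>\<^bsub>A\<^esub> b) = \<phi> a \<cdot>\<^bsub>B\<^esub> \<phi> b) \<and>
     (\<forall>a\<in>carr A. \<phi> (\<sim>\<^bsub>A\<^esub> a) = \<sim>\<^bsub>B\<^esub> (\<phi> a)) \<and>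
     \<phi> \<zero>\<^bsub>A\<^esub> = \<zero>\<^bsub>B\<^esub>}"

definition oml_iso :: "'a ortho_alg \<Rightarrow> 'b ortho_alg \<Rightarrow> ('a \<Rightarrow> 'b) set" where
  "oml_iso A B = {\<phi> \<in> oml_hom A B. \<exists>\<phi>'\<in>oml_hom B A.
     compose (carr A) \<phi>' \<phi> = (\<lambda>a\<in>carr A. a) \<and> compose (carr B) \<phi> \<phi>' = (\<lambda>b\<in>carr B. b)}"

section \<open>Orthomodular frames and spaces\<close>

record 'x ortho_frame =
  pts :: "'x set"
  ord :: "('x \<times> 'x) set"
  prp :: "('x \<times> 'x) set"
  Omg :: "'x set"

record 'x ortho_space = "'x ortho_frame" +
  topo :: "'x topology"

definition frm_le :: "('x, 'm) ortho_frame_scheme \<Rightarrow> 'x \<Rightarrow> 'x \<Rightarrow> bool"  (infix "\<preceq>\<index>" 50)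
  where "x \<preceq>\<^bsub>X\<^esub> y \<longleftrightarrow> (x, y) \<in> ord X"

definition frm_perp :: "('x, 'm) ortho_frame_scheme \<Rightarrow> 'x \<Rightarrow> 'x \<Rightarrow> bool"  (infix "\<bottom>\<index>" 50)
  where "x \<bottom>\<^bsub>X\<^esub> y \<longleftrightarrow> (x, y) \<in> prp X"

definition is_frm_inf :: "('x, 'm) ortho_frame_scheme \<Rightarrow> 'x \<Rightarrow> 'x \<Rightarrow> 'x \<Rightarrow> bool" where
  "is_frm_inf X x y m \<longleftrightarrow> m \<in> pts X \<and> m \<preceq>\<^bsub>X\<^esub> x \<and> m \<preceq>\<^bsub>X\<^esub> y \<and>
     (\<forall>z\<in>pts X. z \<preceq>\<^bsub>X\<^esub> x \<and> z \<preceq>\<^bsub>X\<^esub> y \<longrightarrow> z \<preceq>\<^bsub>X\<^esub> m)"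

definition frm_inf :: "('x, 'm) ortho_frame_scheme \<Rightarrow> 'x \<Rightarrow> 'x \<Rightarrow> 'x" where
  "frm_inf X x y = (THE m. is_frm_inf X x y m)"

definition is_frm_top :: "('x, 'm) ortho_frame_scheme \<Rightarrow> 'x \<Rightarrow> bool" where
  "is_frm_top X w \<longleftrightarrow> w \<in> pts X \<and> (\<forall>x\<in>pts X. x \<preceq>\<^bsub>X\<^esub> w)"

definition frm_top :: "('x, 'm) ortho_frame_scheme \<Rightarrow> 'x"  ("\<omega>\<index>") where
  "\<omega>\<^bsub>X\<^esub> = (THE w. is_frm_top X w)"

definition frm_up :: "('x, 'm) ortho_frame_scheme \<Rightarrow> 'x \<Rightarrow> 'x set" where
  "frm_up X x = {y \<in> pts X. x \<preceq>\<^bsub>X\<^esub> y}"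

definition orth :: "('x, 'm) ortho_frame_scheme \<Rightarrow> 'x set \<Rightarrow> 'x set" where
  "orth X U = {x \<in> pts X. \<forall>y\<in>U. x \<bottom>\<^bsub>X\<^esub> y}"

locale orthomodular_frame =
  fixes X (structure)
  assumes perp_subset: "prp X \<subseteq> pts X \<times> pts X"
    and Omega_subset: "Omg X \<subseteq> pts X"
    and partial_order: "partial_order_on (pts X) (ord X)"
    and ex_inf: "\<lbrakk>x \<in> pts X; y \<in> pts X\<rbrakk> \<Longrightarrow> \<exists>m. is_frm_inf X x y m"
    and ex_top: "\<exists>w. is_frm_top X w"
    and top_Omega: "\<omega> \<in> Omg X"
    and Omega_compl: "x \<in> Omg X \<Longrightarrow> \<exists>z\<in>Omg X.
          (\<forall>y\<in>pts X. x \<bottom> y \<longleftrightarrow> z \<preceq> y) \<and> (\<forall>u\<in>pts X. z \<bottom> u \<longrightarrow> x \<preceq> u)"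
    and Omega_orthomodular: "\<lbrakk>x \<in> Omg X; y \<in> Omg X; y \<preceq> x;
          \<forall>z\<in>pts X. y \<preceq> z \<and> z \<bottom> x \<longrightarrow> z = \<omega>\<rbrakk> \<Longrightarrow> x = y"
    and perp_self: "\<lbrakk>x \<in> pts X; x \<bottom> x\<rbrakk> \<Longrightarrow> x = \<omega>"
    and Omega_inf: "\<lbrakk>x \<in> Omg X; y \<in> Omg X\<rbrakk> \<Longrightarrow> frm_inf X x y \<in> Omg X"
    and perp_top: "x \<in> pts X \<Longrightarrow> x \<bottom> \<omega>"
    and perp_sym: "\<lbrakk>x \<in> pts X; y \<in> pts X; x \<bottom> y\<rbrakk> \<Longrightarrow> y \<bottom> x"
    and perp_mono: "\<lbrakk>x \<in> pts X; y \<in> pts X; z \<in> pts X; x \<bottom> y; x \<preceq> z\<rbrakk> \<Longrightarrow> z \<bottom> y"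

definition clopen_stable :: "('x, 'm) ortho_space_scheme \<Rightarrow> 'x set set" where
  "clopen_stable X = {U. openin (topo X) U \<and> closedin (topo X) U \<and> U = orth X (orth X U)}"

locale orthomodular_space = orthomodular_frame +
  assumes topspace_eq: "topspace (topo X) = pts X"
    and compact: "compact_space (topo X)"
    and stable_Int: "\<lbrakk>U \<in> clopen_stable X; V \<in> clopen_stable X\<rbrakk> \<Longrightarrow> U \<inter> V \<in> clopen_stable X"
    and stable_orth: "U \<in> clopen_stable X \<Longrightarrow> orth X U \<in> clopen_stable X"
    and stable_up: "U \<in> clopen_stable X \<Longrightarrow> \<exists>z\<in>Omg X. U = frm_up X z"
    and separate_le: "\<lbrakk>x \<in> pts X; y \<in> pts X; \<not> x \<preceq> y\<rbrakk> \<Longrightarrow>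
          \<exists>U\<in>clopen_stable X. x \<in> U \<and> y \<notin> U"
    and separate_perp: "\<lbrakk>x \<in> pts X; y \<in> pts X; x \<bottom> y\<rbrakk> \<Longrightarrow>
          \<exists>U\<in>clopen_stable X. x \<in> U \<and> y \<in> orth X U"

text \<open>The arrows are the continuous weak p-morphisms.\<close>

definition oms_hom :: "'x ortho_space \<Rightarrow> 'y ortho_space \<Rightarrow> ('x \<Rightarrow> 'y) set" where
  "oms_hom X Y = {\<psi> \<in> pts X \<rightarrow>\<^sub>E pts Y. continuous_map (topo X) (topo Y) \<psi> \<and>
     (\<forall>x\<in>pts X. \<forall>y\<in>pts X. \<not> x \<bottom>\<^bsub>X\<^esub> y \<longrightarrow> \<not> \<psi> x \<bottom>\<^bsub>Y\<^esub> \<psi> y) \<and>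
     (\<forall>z\<in>pts Y. \<forall>y\<in>pts X. \<not> z \<bottom>\<^bsub>Y\<^esub> \<psi> y \<longrightarrow>
        (\<exists>x\<in>pts X. \<not> x \<bottom>\<^bsub>X\<^esub> y \<and> z \<preceq>\<^bsub>Y\<^esub> \<psi> x))}"

definition oms_iso :: "'x ortho_space \<Rightarrow> 'y ortho_space \<Rightarrow> ('x \<Rightarrow> 'y) set" where
  "oms_iso X Y = {\<psi> \<in> oms_hom X Y. \<exists>\<psi>'\<in>oms_hom Y X.
     compose (pts X) \<psi>' \<psi> = (\<lambda>x\<in>pts X. x) \<and> compose (pts Y) \<psi> \<psi>' = (\<lambda>y\<in>pts Y. y)}"

section \<open>The functors\<close>

definition filters :: "'a ortho_alg \<Rightarrow> 'a set set" where
  "filters A = {F. F \<subseteq> carr A \<and> F \<noteq> {} \<and>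
     (\<forall>a\<in>F. \<forall>b\<in>carr A. a \<sqsubseteq>\<^bsub>A\<^esub> b \<longrightarrow> b \<in> F) \<and> (\<forall>a\<in>F. \<forall>b\<in>F. a \<cdot>\<^bsub>A\<^esub> b \<in> F)}"

definition principal_filters :: "'a ortho_alg \<Rightarrow> 'a set set" where
  "principal_filters A = {{b \<in> carr A. a \<sqsubseteq>\<^bsub>A\<^esub> b} | a. a \<in> carr A}"

definition hset :: "'a ortho_alg \<Rightarrow> 'a \<Rightarrow> 'a set set" where
  "hset A a = {x \<in> filters A. a \<in> x}"

definition S0 :: "'a ortho_alg \<Rightarrow> 'a set ortho_space" where
  "S0 A = \<lparr>pts = filters A,
     ord = {(x, y). x \<in> filters A \<and> y \<in> filters A \<and> x \<subseteq> y},
     prp = {(x, y). x \<in> filters A \<and> y \<in> filters A \<and> (\<exists>a\<in>x. \<sim>\<^bsub>A\<^esub> a \<in> y)},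
     Omg = principal_filters A,
     topo = topology_generated_by
       (hset A ` carr A \<union> (\<lambda>a. filters A - hset A a) ` carr A)\<rparr>"

text \<open>The action on arrows is contravariant: \<open>S1 A B \<phi>\<close> is an arrow from \<open>S0 B\<close> to \<open>S0 A\<close> for
  \<open>\<phi>\<close> from \<open>A\<close> to \<open>B\<close>, and likewise for \<open>A1\<close>.\<close>

definition S1 :: "'a ortho_alg \<Rightarrow> 'b ortho_alg \<Rightarrow> ('a \<Rightarrow> 'b) \<Rightarrow> 'b set \<Rightarrow> 'a set" where
  "S1 A B \<phi> = (\<lambda>x\<in>filters B. {a \<in> carr A. \<phi> a \<in> x})"

definition A0 :: "'x ortho_space \<Rightarrow> 'x set ortho_alg" where
  "A0 X = \<lparr>carr = clopen_stable X, mt = (\<inter>), cmpl = orth X, zer = {\<omega>\<^bsub>X\<^esub>}\<rparr>"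

definition A1 :: "'x ortho_space \<Rightarrow> 'y ortho_space \<Rightarrow> ('x \<Rightarrow> 'y) \<Rightarrow> 'y set \<Rightarrow> 'x set" where
  "A1 X Y \<psi> = (\<lambda>U\<in>clopen_stable Y. {x \<in> pts X. \<psi> x \<in> U})"

section \<open>Components of the natural isomorphisms\<close>

text \<open>Both functors raise the carrier type by a powerset, so the round trip of an object lives over
  a different type than the object itself. The components below are therefore arrows between objects
  over different types, polymorphic in the type of the object; they go from an object to its round
  trip.\<close>

definition eta :: "'a ortho_alg \<Rightarrow> 'a \<Rightarrow> 'a set set" where
  "eta A = (\<lambda>a\<in>carr A. hset A a)"

definition eps :: "'x ortho_space \<Rightarrow> 'x \<Rightarrow> 'x set set" where
  "eps X = (\<lambda>x\<in>pts X. {U \<in> clopen_stable X. x \<in> U})"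

end

(* A clopen stable set U of filters is an up-set, so it is covered by the sets h(a) inside U; by
   compactness finitely many suffice, hence the orthocomplement of U, and then U itself, is some h(c).
   So eta is a bijection. For eps, a filter F of clopen stable sets is realised by a point by the
   finite intersection property, since clopen stable sets are principal up-sets; eps preserves and
   reflects orthogonality by the separation axioms, and it is a homeomorphism as a continuous
   bijection from a compact to a Hausdorff space. Weak p-morphisms are monotone, because preimages
   of clopen stable sets are clopen stable; this is what makes them compose. *)

theory Submission
  imports Defs
begin

section \<open>Lattices and their filters\<close>

text \<open>The filters are arbitrary, not prime: one containing a join need not contain either of
  the two elements. So \<open>hset\<close> turns meets into intersections but in general not joins
  into unions, and a finite union of such sets has to be treated through its orthocomplement, which
  is an intersection of sets \<open>hset L (\<sim> d)\<close> and thus \<open>hset\<close> of a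
  meet. Stability carries the result back to the union.

  The other obstacle is the orthomodular law, since the sets stable under an orthogonality relation
  form in general only an ortholattice. The law is used in the equivalent form: a \<le> b and -a
  \<cdot> b = 0 imply a = b. For the principal filters of a and b, whose inclusion reverses the
  order of the lattice, this is exactly the condition \<open>Omega_orthomodular\<close>, because a
  filter contains both b and -a iff it contains -a \<cdot> b. In a space every clopen stable set is
  the up-set of a point of \<open>Omg X\<close>, and so the condition on points comes back as a
  condition on sets.\<close>

context ortholattice
begin

lemma le_iff: "a \<sqsubseteq> b \<longleftrightarrow> a \<cdot> b = a"
  by (simp add: alg_le_def)

lemma le_refl: "a \<in> carr L \<Longrightarrow> a \<sqsubseteq> a"
  by (simp add: le_iff meet_idem)

lemma le_antisym: "\<lbrakk>a \<in> carr L; b \<in> carr L; a \<sqsubseteq> b; b \<sqsubseteq> a\<rbrakk> \<Longrightarrow> a = b"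
  by (metis le_iff meet_comm)

lemma le_trans: "\<lbrakk>a \<in> carr L; b \<in> carr L; c \<in> carr L; a \<sqsubseteq> b; b \<sqsubseteq> c\<rbrakk> \<Longrightarrow> a \<sqsubseteq> c"
  by (metis le_iff meet_assoc)

lemma meet_le1: "\<lbrakk>a \<in> carr L; b \<in> carr L\<rbrakk> \<Longrightarrow> a \<cdot> b \<sqsubseteq> a"
  by (metis le_iff meet_assoc meet_comm meet_idem)

lemma meet_le2: "\<lbrakk>a \<in> carr L; b \<in> carr L\<rbrakk> \<Longrightarrow> a \<cdot> b \<sqsubseteq> b"
  by (metis meet_comm meet_le1)

lemma le_meet: "\<lbrakk>a \<in> carr L; b \<in> carr L; c \<in> carr L; c \<sqsubseteq> a; c \<sqsubseteq> b\<rbrakk> \<Longrightarrow> c \<sqsubseteq> a \<cdot> b"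
  by (metis le_iff meet_assoc)

lemma meet_mono:
  assumes "a \<in> carr L" "b \<in> carr L" "c \<in> carr L" "d \<in> carr L" "a \<sqsubseteq> c" "b \<sqsubseteq> d"
  shows "a \<cdot> b \<sqsubseteq> c \<cdot> d"
proof (rule le_meet)
  show "a \<cdot> b \<sqsubseteq> c"
    using assms by (intro le_trans[OF _ _ _ meet_le1]) (auto simp: meet_closed)
  show "a \<cdot> b \<sqsubseteq> d"
    using assms by (intro le_trans[OF _ _ _ meet_le2]) (auto simp: meet_closed)
qed (use assms in \<open>auto simp: meet_closed\<close>)

lemma compl_le_swap: "\<lbrakk>a \<in> carr L; b \<in> carr L; a \<sqsubseteq> \<sim> b\<rbrakk> \<Longrightarrow> b \<sqsubseteq> \<sim> a"
  by (metis compl_antitone compl_closed compl_compl)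

lemma le_compl_zero: "a \<in> carr L \<Longrightarrow> a \<sqsubseteq> \<sim> \<zero>"
  by (simp add: compl_le_swap compl_closed zero_closed zero_least)

lemma join_closed: "\<lbrakk>a \<in> carr L; b \<in> carr L\<rbrakk> \<Longrightarrow> a \<squnion> b \<in> carr L"
  by (simp add: alg_join_def compl_closed meet_closed)

lemma join_ge1: "\<lbrakk>a \<in> carr L; b \<in> carr L\<rbrakk> \<Longrightarrow> a \<sqsubseteq> a \<squnion> b"
  by (simp add: alg_join_def compl_closed meet_closed compl_le_swap meet_le1)

lemma join_ge2: "\<lbrakk>a \<in> carr L; b \<in> carr L\<rbrakk> \<Longrightarrow> b \<sqsubseteq> a \<squnion> b"
  by (simp add: alg_join_def compl_closed meet_closed compl_le_swap meet_le2)

lemma join_least: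
  assumes "a \<in> carr L" "b \<in> carr L" "c \<in> carr L" "a \<sqsubseteq> c" "b \<sqsubseteq> c"
  shows "a \<squnion> b \<sqsubseteq> c"
proof -
  have "\<sim> c \<sqsubseteq> \<sim> a \<cdot> \<sim> b"
    using assms by (simp add: compl_antitone compl_closed le_meet)
  then have "\<sim> (\<sim> a \<cdot> \<sim> b) \<sqsubseteq> \<sim> (\<sim> c)"
    using assms by (simp add: compl_antitone compl_closed meet_closed)
  then show ?thesis
    using assms by (simp add: alg_join_def flip: compl_compl)
qed

lemma join_zero: "a \<in> carr L \<Longrightarrow> a \<squnion> \<zero> = a"
  by (meson join_closed join_ge1 join_least le_antisym le_refl zero_closed zero_least)

end

text \<open>The functors are defined on records without extension only.\<close>

locale plain_oml = orthomodular_lattice L for L :: "'a ortho_alg" (structure)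

section \<open>Filters and principal filters of a lattice\<close>

context plain_oml
begin

lemma filter_subset: "x \<in> filters L \<Longrightarrow> a \<in> x \<Longrightarrow> a \<in> carr L"
  by (auto simp: filters_def)

lemma filter_up: "\<lbrakk>x \<in> filters L; a \<in> x; a \<sqsubseteq> b; b \<in> carr L\<rbrakk> \<Longrightarrow> b \<in> x"
  by (auto simp: filters_def)

lemma filter_meet: "\<lbrakk>x \<in> filters L; a \<in> x; b \<in> x\<rbrakk> \<Longrightarrow> a \<cdot> b \<in> x"
  by (auto simp: filters_def)

lemma filter_meet_iff:
  "\<lbrakk>x \<in> filters L; a \<in> carr L; b \<in> carr L\<rbrakk> \<Longrightarrow> a \<cdot> b \<in> x \<longleftrightarrow> a \<in> x \<and> b \<in> x"
  by (meson filter_meet filter_up meet_closed meet_le1 meet_le2)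

lemma filter_compl_zero: "x \<in> filters L \<Longrightarrow> \<sim> \<zero> \<in> x"
  unfolding filters_def using le_compl_zero compl_closed zero_closed by blast

lemma filterI:
  assumes "F \<subseteq> carr L" "\<sim> \<zero> \<in> F" "\<And>a b. \<lbrakk>a \<in> F; b \<in> carr L; a \<sqsubseteq> b\<rbrakk> \<Longrightarrow> b \<in> F"
    "\<And>a b. \<lbrakk>a \<in> F; b \<in> F\<rbrakk> \<Longrightarrow> a \<cdot> b \<in> F"
  shows "F \<in> filters L"
  using assms by (auto simp: filters_def)

lemma carr_filter: "carr L \<in> filters L"
  by (rule filterI) (auto simp: compl_closed zero_closed meet_closed)

lemma filter_eq_carr: "\<lbrakk>x \<in> filters L; \<zero> \<in> x\<rbrakk> \<Longrightarrow> x = carr L"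
  by (metis filter_subset filter_up subsetI subset_antisym zero_least)

lemma Int_filter: "\<lbrakk>x \<in> filters L; y \<in> filters L\<rbrakk> \<Longrightarrow> x \<inter> y \<in> filters L"
  by (rule filterI) (auto intro: filter_compl_zero filter_subset filter_up filter_meet)

definition above :: "'a \<Rightarrow> 'a set" where
  "above a = {b \<in> carr L. a \<sqsubseteq> b}"

lemma above_iff: "b \<in> above a \<longleftrightarrow> b \<in> carr L \<and> a \<sqsubseteq> b"
  by (simp add: above_def)

lemma principal_filters_eq: "principal_filters L = above ` carr L"
  by (auto simp: principal_filters_def above_def)

lemma above_filter: "a \<in> carr L \<Longrightarrow> above a \<in> filters L"
  unfolding above_def
  by (rule filterI) (auto simp: compl_closed zero_closed meet_closed le_compl_zero le_meet intro: le_trans)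

lemma above_self: "a \<in> carr L \<Longrightarrow> a \<in> above a"
  by (simp add: above_def le_refl)

lemma above_subset_iff: "\<lbrakk>a \<in> carr L; x \<in> filters L\<rbrakk> \<Longrightarrow> above a \<subseteq> x \<longleftrightarrow> a \<in> x"
  using above_self filter_up by (fastforce simp: above_def)

text \<open>Principal filters reverse the order, so an infimum of them belongs to a join. This
  closes \<open>Omg (S0 L)\<close> under infima.\<close>

lemma above_Int: "\<lbrakk>a \<in> carr L; b \<in> carr L\<rbrakk> \<Longrightarrow> above a \<inter> above b = above (a \<squnion> b)"
  unfolding above_def
  by (auto intro: join_least le_trans[OF _ _ _ join_ge1] le_trans[OF _ _ _ join_ge2] join_closed)

lemma above_zero: "above \<zero> = carr L"
  by (auto simp: above_def zero_least)

end

section \<open>The space of filters\<close>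

lemma pts_S0 [simp]: "pts (S0 A) = filters A"
  and ord_S0: "x \<preceq>\<^bsub>S0 A\<^esub> y \<longleftrightarrow> x \<in> filters A \<and> y \<in> filters A \<and> x \<subseteq> y"
  and prp_S0: "x \<bottom>\<^bsub>S0 A\<^esub> y \<longleftrightarrow> x \<in> filters A \<and> y \<in> filters A \<and> (\<exists>a\<in>x. \<sim>\<^bsub>A\<^esub> a \<in> y)"
  and Omg_S0 [simp]: "Omg (S0 A) = principal_filters A"
  and topo_S0: "topo (S0 A) = topology_generated_by
       (hset A ` carr A \<union> (\<lambda>a. filters A - hset A a) ` carr A)"
  by (simp_all add: S0_def frm_le_def frm_perp_def)

context plain_oml
begin

lemma hset_iff: "x \<in> hset L a \<longleftrightarrow> x \<in> filters L \<and> a \<in> x"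
  by (simp add: hset_def)

lemma hset_subset: "hset L a \<subseteq> filters L"
  by (auto simp: hset_iff)

lemma hset_meet: "\<lbrakk>a \<in> carr L; b \<in> carr L\<rbrakk> \<Longrightarrow> hset L (a \<cdot> b) = hset L a \<inter> hset L b"
  by (auto simp: hset_iff filter_meet_iff)

lemma hset_zero: "hset L \<zero> = {carr L}"
  by (auto simp: hset_iff carr_filter zero_closed dest: filter_eq_carr)

lemma hset_compl_zero: "hset L (\<sim> \<zero>) = filters L"
  using filter_compl_zero by (auto simp: hset_iff)

text \<open>The least member of \<open>hset L a\<close> is \<open>above a\<close>, and this filter
  determines \<open>a\<close>.\<close>

lemma hset_inj: "inj_on (hset L) (carr L)"
proof (rule inj_onI)
  fix a b assume ab: "a \<in> carr L" "b \<in> carr L" "hset L a = hset L b"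
  have "above a \<in> hset L b" "above b \<in> hset L a"
    using ab above_filter above_self hset_iff by metis+
  then have "b \<in> above a" "a \<in> above b"
    by (simp_all add: hset_iff)
  then show "a = b"
    using ab(1,2) by (simp add: above_def le_antisym)
qed

lemma is_top_S0: "is_frm_top (S0 L) w \<longleftrightarrow> w = carr L"
  using carr_filter filter_subset by (fastforce simp: is_frm_top_def ord_S0)

lemma top_S0: "\<omega>\<^bsub>S0 L\<^esub> = carr L"
  by (simp add: frm_top_def is_top_S0)

lemma is_inf_S0:
  assumes "x \<in> filters L" "y \<in> filters L"
  shows "is_frm_inf (S0 L) x y m \<longleftrightarrow> m = x \<inter> y"
proof
  assume m: "is_frm_inf (S0 L) x y m"
  then have "x \<inter> y \<subseteq> m"
    using Int_filter[OF assms] assms by (auto simp: is_frm_inf_def ord_S0)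
  with m show "m = x \<inter> y"
    by (auto simp: is_frm_inf_def ord_S0)
qed (use Int_filter[OF assms] assms in \<open>auto simp: is_frm_inf_def ord_S0\<close>)

lemma inf_S0: "\<lbrakk>x \<in> filters L; y \<in> filters L\<rbrakk> \<Longrightarrow> frm_inf (S0 L) x y = x \<inter> y"
  by (simp add: frm_inf_def is_inf_S0)

lemma perp_sym_S0: "x \<bottom>\<^bsub>S0 L\<^esub> y \<Longrightarrow> y \<bottom>\<^bsub>S0 L\<^esub> x"
  unfolding prp_S0 by (metis compl_compl filter_subset)

text \<open>Any witness \<open>b\<close> of orthogonality lies above \<open>a\<close>, so its
  complement lies below that of \<open>a\<close>; hence \<open>a\<close> itself can serve as the
  witness.\<close>

lemma perp_above_iff:
  assumes "a \<in> carr L" "x \<in> filters L"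
  shows "above a \<bottom>\<^bsub>S0 L\<^esub> x \<longleftrightarrow> \<sim> a \<in> x"
proof
  assume "above a \<bottom>\<^bsub>S0 L\<^esub> x"
  then obtain b where "b \<in> carr L" "a \<sqsubseteq> b" "\<sim> b \<in> x"
    by (auto simp: prp_S0 above_def)
  then show "\<sim> a \<in> x"
    using assms by (meson compl_antitone compl_closed filter_up)
qed (use assms above_filter above_self in \<open>auto simp: prp_S0\<close>)

text \<open>As \<open>above a\<close> is the least filter containing \<open>a\<close>, orthogonality
  to it decides orthogonality to all of \<open>hset L a\<close>.\<close>

lemma orth_hset: "a \<in> carr L \<Longrightarrow> orth (S0 L) (hset L a) = hset L (\<sim> a)"
proof (rule set_eqI, rule iffI)
  fix x assume a: "a \<in> carr L" and x: "x \<in> orth (S0 L) (hset L a)"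
  then have "x \<in> filters L" "x \<bottom>\<^bsub>S0 L\<^esub> above a"
    using above_filter above_self by (auto simp: orth_def hset_iff)
  then show "x \<in> hset L (\<sim> a)"
    using perp_above_iff[of a x] perp_sym_S0 a by (metis hset_iff)
next
  fix x assume a: "a \<in> carr L" and x: "x \<in> hset L (\<sim> a)"
  then have "x \<in> filters L" "\<forall>y\<in>hset L a. y \<bottom>\<^bsub>S0 L\<^esub> x"
    by (auto simp: hset_iff prp_S0)
  then show "x \<in> orth (S0 L) (hset L a)"
    unfolding orth_def pts_S0 using perp_sym_S0 by blast
qed

lemma hset_eq_up: "a \<in> carr L \<Longrightarrow> hset L a = frm_up (S0 L) (above a)"
  by (rule set_eqI) (simp add: hset_iff frm_up_def ord_S0 above_filter above_subset_iff conj_commute cong: conj_cong)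

end

section \<open>The frame conditions for filters\<close>

lemma (in plain_oml) orthomodular_frame_S0: "orthomodular_frame (S0 L)"
proof
  show "prp (S0 L) \<subseteq> pts (S0 L) \<times> pts (S0 L)"
    by (auto simp: S0_def)
  show "Omg (S0 L) \<subseteq> pts (S0 L)"
    by (auto simp: principal_filters_eq above_filter)
  show "partial_order_on (pts (S0 L)) (ord (S0 L))"
    by (auto simp: S0_def partial_order_on_def preorder_on_def refl_on_def intro!: transI antisymI)
  show "\<exists>m. is_frm_inf (S0 L) x y m" if "x \<in> pts (S0 L)" "y \<in> pts (S0 L)" for x y
    using that by (simp add: is_inf_S0)
  show "\<exists>w. is_frm_top (S0 L) w"
    by (simp add: is_top_S0)
  show "\<omega>\<^bsub>S0 L\<^esub> \<in> Omg (S0 L)"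
    using above_zero zero_closed by (auto simp: top_S0 principal_filters_eq)
next
  fix x assume "x \<in> Omg (S0 L)"
  then obtain a where a: "a \<in> carr L" "x = above a"
    by (auto simp: principal_filters_eq)
  have "\<forall>y\<in>filters L. x \<bottom>\<^bsub>S0 L\<^esub> y \<longleftrightarrow> above (\<sim> a) \<preceq>\<^bsub>S0 L\<^esub> y"
    using a by (simp add: perp_above_iff ord_S0 above_filter compl_closed above_subset_iff)
  moreover have "\<forall>u\<in>filters L. above (\<sim> a) \<bottom>\<^bsub>S0 L\<^esub> u \<longrightarrow> x \<preceq>\<^bsub>S0 L\<^esub> u"
    using a by (simp add: perp_above_iff ord_S0 above_filter compl_closed above_subset_iff
        flip: compl_compl)
  ultimately show "\<exists>z\<in>Omg (S0 L). (\<forall>y\<in>pts (S0 L). x \<bottom>\<^bsub>S0 L\<^esub> y \<longleftrightarrow> z \<preceq>\<^bsub>S0 L\<^esub> y) \<and>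
      (\<forall>u\<in>pts (S0 L). z \<bottom>\<^bsub>S0 L\<^esub> u \<longrightarrow> x \<preceq>\<^bsub>S0 L\<^esub> u)"
    using a by (intro bexI[of _ "above (\<sim> a)"]) (auto simp: principal_filters_eq compl_closed)
next
  fix x y assume "x \<in> Omg (S0 L)" "y \<in> Omg (S0 L)" and yx: "y \<preceq>\<^bsub>S0 L\<^esub> x"
    and top: "\<forall>z\<in>pts (S0 L). y \<preceq>\<^bsub>S0 L\<^esub> z \<and> z \<bottom>\<^bsub>S0 L\<^esub> x \<longrightarrow> z = \<omega>\<^bsub>S0 L\<^esub>"
  then obtain a b where a: "a \<in> carr L" "x = above a" and b: "b \<in> carr L" "y = above b"
    by (auto simp: principal_filters_eq)
  have ab: "a \<sqsubseteq> b"
    using yx a b by (simp add: ord_S0 above_filter above_subset_iff above_iff)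
  \<comment> \<open>In the orthomodular law \<open>?c\<close> is the gap between \<open>a\<close>
    and \<open>b\<close>. The filter it generates is one of the \<open>z\<close> in the hypothesis,
    hence improper, and so the gap is zero.\<close>
  let ?c = "\<sim> a \<cdot> b"
  have c: "?c \<in> carr L"
    using a b by (simp add: meet_closed compl_closed)
  have "y \<preceq>\<^bsub>S0 L\<^esub> above ?c"
    using a b c meet_le2[of "\<sim> a" b]
    by (simp add: ord_S0 above_filter above_subset_iff above_iff compl_closed)
  moreover have "above ?c \<bottom>\<^bsub>S0 L\<^esub> x"
  proof (rule perp_sym_S0)
    show "x \<bottom>\<^bsub>S0 L\<^esub> above ?c"
      using a b c meet_le1[of "\<sim> a" b] by (simp add: perp_above_iff above_filter above_iff compl_closed)
  qed
  ultimately have "above ?c = carr L"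
    using top c by (auto simp: above_filter top_S0)
  then have "?c = \<zero>"
    using c zero_closed by (metis above_iff le_antisym zero_least)
  then have "b = a"
    using orthomodular[OF a(1) b(1) ab] join_zero a by simp
  then show "x = y"
    using a b by simp
next
  fix x assume "x \<in> pts (S0 L)" "x \<bottom>\<^bsub>S0 L\<^esub> x"
  then obtain a where x: "x \<in> filters L" and a: "a \<in> x" "\<sim> a \<in> x"
    by (auto simp: prp_S0)
  then have "\<zero> \<in> x"
    by (metis filter_meet filter_subset meet_compl)
  then show "x = \<omega>\<^bsub>S0 L\<^esub>"
    using x by (simp add: filter_eq_carr top_S0)
next
  fix x y assume "x \<in> Omg (S0 L)" "y \<in> Omg (S0 L)"
  then show "frm_inf (S0 L) x y \<in> Omg (S0 L)"
    by (auto simp: principal_filters_eq inf_S0 above_filter above_Int join_closed)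
next
  fix x assume "x \<in> pts (S0 L)"
  then show "x \<bottom>\<^bsub>S0 L\<^esub> \<omega>\<^bsub>S0 L\<^esub>"
    using filter_compl_zero[of x] carr_filter compl_closed zero_closed
    by (auto simp: prp_S0 top_S0)
next
  fix x y assume "x \<bottom>\<^bsub>S0 L\<^esub> y"
  then show "y \<bottom>\<^bsub>S0 L\<^esub> x"
    by (rule perp_sym_S0)
next
  fix x y z assume "x \<bottom>\<^bsub>S0 L\<^esub> y" "x \<preceq>\<^bsub>S0 L\<^esub> z"
  then show "z \<bottom>\<^bsub>S0 L\<^esub> y"
    by (auto simp: prp_S0 ord_S0)
qed

text \<open>This makes \<open>Alexander_subbase\<close> applicable to the inductively generated topology.\<close>

lemma topology_generated_by_eq_subbase:
  "topology (arbitrary union_of (finite intersection_of (\<lambda>x. x \<in> \<B>) relative_to \<Union>\<B>)) =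
    topology_generated_by \<B>" (is "?T = _")
proof (rule topology_eq[THEN iffD2], intro allI iffI)
  fix S assume "openin ?T S"
  then show "openin (topology_generated_by \<B>) S"
    by (rule minimal_topology_subbase[rotated 2])
      (auto intro: topology_generated_by_Basis simp flip: topology_generated_by_topspace)
next
  fix S assume "openin (topology_generated_by \<B>) S"
  then have "generate_topology_on \<B> S"
    by (rule openin_topology_generated_by)
  then show "openin ?T S"
  proof induction
    case (Basis s)
    then have "\<Union>\<B> \<inter> s = s"
      by blast
    then have "(finite intersection_of (\<lambda>x. x \<in> \<B>) relative_to \<Union>\<B>) s"
      using Basis by (metis finite_intersection_of_inc relative_to_inc)
    then show ?case
      by (simp add: openin_subbase arbitrary_union_of_inc)
  qed auto
qed

section \<open>Topology of the filter space and its clopen stable sets\<close>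

context plain_oml
begin

lemma topspace_S0 [simp]: "topspace (topo (S0 L)) = filters L"
  using hset_compl_zero compl_closed zero_closed hset_subset
  by (fastforce simp: topo_S0)

lemma openin_hset: "a \<in> carr L \<Longrightarrow> openin (topo (S0 L)) (hset L a)"
  by (auto simp: topo_S0 intro: topology_generated_by_Basis)

lemma closedin_hset: "a \<in> carr L \<Longrightarrow> closedin (topo (S0 L)) (hset L a)"
  unfolding closedin_def topspace_S0
  by (auto simp: hset_subset topo_S0 intro: topology_generated_by_Basis)

text \<open>The elements lying in every filter that contains \<open>S\<close>, for some finite \<open>S \<subseteq> Q\<close>, form the filter
  generated by \<open>Q\<close>. A cover of all filters by subbasic sets \<open>h(a)\<close>, \<open>a \<in> P\<close>, and complements of \<open>h(b)\<close>,
  \<open>b \<in> Q\<close>, has to cover this filter by some \<open>h(a)\<close>, and then \<open>a\<close> lies in every filter containing a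
  finite part of \<open>Q\<close>.\<close>

lemma compact_space_S0: "compact_space (topo (S0 L))"
  unfolding topo_S0
proof (rule Alexander_subbase)
  let ?B = "hset L ` carr L \<union> (\<lambda>a. filters L - hset L a) ` carr L"
  show "topology (arbitrary union_of (finite intersection_of (\<lambda>x. x \<in> ?B) relative_to \<Union>?B)) =
      topology_generated_by ?B"
    by (rule topology_generated_by_eq_subbase)
  fix C assume CB: "C \<subseteq> ?B" and "\<Union>C = topspace (topology_generated_by ?B)"
  then have C: "\<Union>C = filters L"
    using topspace_S0 by (simp add: topo_S0)
  define Q where "Q = {b \<in> carr L. filters L - hset L b \<in> C}"
  define G where "G = {c \<in> carr L. \<exists>S. finite S \<and> S \<subseteq> Q \<and> (\<forall>x\<in>filters L. S \<subseteq> x \<longrightarrow> c \<in> x)}"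
  have G: "G \<in> filters L"
  proof (rule filterI)
    show "\<sim> \<zero> \<in> G"
      using filter_compl_zero by (auto simp: G_def compl_closed zero_closed intro!: exI[of _ "{}"])
    show "b \<in> G" if "a \<in> G" "b \<in> carr L" "a \<sqsubseteq> b" for a b
    proof -
      obtain S where S: "finite S" "S \<subseteq> Q" "\<forall>x\<in>filters L. S \<subseteq> x \<longrightarrow> a \<in> x"
        using \<open>a \<in> G\<close> unfolding G_def by blast
      then have "\<forall>x\<in>filters L. S \<subseteq> x \<longrightarrow> b \<in> x"
        using filter_up[OF _ _ \<open>a \<sqsubseteq> b\<close> \<open>b \<in> carr L\<close>] by blast
      then show ?thesis
        using S \<open>b \<in> carr L\<close> unfolding G_def by blast
    qed
    show "a \<cdot> b \<in> G" if ab: "a \<in> G" "b \<in> G" for a b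
    proof -
      obtain S T where "finite S" "S \<subseteq> Q" "\<forall>x\<in>filters L. S \<subseteq> x \<longrightarrow> a \<in> x"
        "finite T" "T \<subseteq> Q" "\<forall>x\<in>filters L. T \<subseteq> x \<longrightarrow> b \<in> x"
        using ab unfolding G_def by blast
      then have "finite (S \<union> T)" "S \<union> T \<subseteq> Q" "\<forall>x\<in>filters L. S \<union> T \<subseteq> x \<longrightarrow> a \<cdot> b \<in> x"
        by (auto simp: filter_meet)
      moreover have "a \<cdot> b \<in> carr L"
        using ab by (simp add: G_def meet_closed)
      ultimately show ?thesis
        unfolding G_def by blast
    qed
  qed (auto simp: G_def)
  have "Q \<subseteq> G"
  proof
    fix b assume "b \<in> Q"
    then show "b \<in> G"
      unfolding G_def Q_def by (auto intro!: exI[of _ "{b}"])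
  qed
  obtain U where U: "U \<in> C" "G \<in> U"
    using G C by blast
  \<comment> \<open>If the complement of \<open>hset L b\<close> belongs to the cover, then
    \<open>b\<close> lies in \<open>Q\<close> and so in \<open>G\<close>; such a complement misses
    \<open>G\<close>.\<close>
  have "U \<in> hset L ` carr L"
  proof (rule ccontr)
    assume "U \<notin> hset L ` carr L"
    then obtain b where b: "b \<in> carr L" "U = filters L - hset L b"
      using U CB by blast
    then have "b \<in> G"
      using U(1) \<open>Q \<subseteq> G\<close> by (auto simp: Q_def)
    then show False
      using b U(2) by (simp add: hset_iff)
  qed
  then obtain a where "a \<in> carr L" "U = hset L a" "a \<in> G"
    using U by (auto simp: hset_iff)
  then obtain S where S: "finite S" "S \<subseteq> Q" "\<forall>x\<in>filters L. S \<subseteq> x \<longrightarrow> x \<in> U"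
    by (auto simp: G_def hset_iff)
  \<comment> \<open>A filter outside all these complements contains \<open>S\<close> and therefore
    lies in \<open>U\<close>.\<close>
  let ?C' = "insert U ((\<lambda>b. filters L - hset L b) ` S)"
  have "?C' \<subseteq> C"
    using S U by (auto simp: Q_def)
  moreover have "filters L \<subseteq> \<Union>?C'"
    using S by (auto simp: hset_iff)
  ultimately have "\<Union>?C' = filters L"
    using C by blast
  then show "\<exists>C'. finite C' \<and> C' \<subseteq> C \<and> \<Union>C' = topspace (topology_generated_by ?B)"
    using \<open>?C' \<subseteq> C\<close> S(1) topspace_S0 unfolding topo_S0 by (intro exI[of _ ?C']) auto
qed

lemma Hausdorff_space_S0: "Hausdorff_space (topo (S0 L))"
  unfolding Hausdorff_space_def topspace_S0
proof (intro allI impI)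
  have *: "\<exists>U V. openin (topo (S0 L)) U \<and> openin (topo (S0 L)) V \<and> x \<in> U \<and> y \<in> V \<and> disjnt U V"
    if "x \<in> filters L" "y \<in> filters L" "a \<in> x" "a \<notin> y" for x y a
    using that openin_hset[of a] closedin_hset[of a]
    by (intro exI[of _ "hset L a"] exI[of _ "filters L - hset L a"])
      (auto simp: filter_subset closedin_def hset_iff disjnt_def)
  fix x y assume xy: "x \<in> filters L \<and> y \<in> filters L \<and> x \<noteq> y"
  then consider a where "a \<in> x" "a \<notin> y" | a where "a \<in> y" "a \<notin> x"
    by blast
  then show "\<exists>U V. openin (topo (S0 L)) U \<and> openin (topo (S0 L)) V \<and> x \<in> U \<and> y \<in> V \<and> disjnt U V"
  proof cases
    case 1
    then show ?thesis
      using *[of x y a] xy by simp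
  next
    case 2
    then show ?thesis
      using *[of y x a] xy by (metis disjnt_sym)
  qed
qed

text \<open>One positive condition is enough, because \<open>a \<in> y\<close> and
  \<open>b \<in> y\<close> together say \<open>a \<cdot> b \<in> y\<close>. Negative conditions do
  not merge in this way and are collected in \<open>S\<close>.\<close>

lemma openin_S0_nhd:
  assumes "openin (topo (S0 L)) W" "x \<in> W"
  shows "\<exists>a\<in>x. \<exists>S. S \<inter> x = {} \<and> (\<forall>y\<in>filters L. a \<in> y \<and> S \<inter> y = {} \<longrightarrow> y \<in> W)"
proof -
  have "generate_topology_on (hset L ` carr L \<union> (\<lambda>a. filters L - hset L a) ` carr L) W"
    using assms(1) by (simp add: topo_S0 openin_topology_generated_by)
  then show ?thesis
    using assms(2)
  proof (induction arbitrary: x)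
    case (Int U V)
    then have xUV: "x \<in> U" "x \<in> V"
      by auto
    obtain a S where aS: "a \<in> x" "S \<inter> x = {}"
      and US: "\<And>y. \<lbrakk>y \<in> filters L; a \<in> y; S \<inter> y = {}\<rbrakk> \<Longrightarrow> y \<in> U"
      using Int.IH(1)[OF xUV(1)] by meson
    obtain b T where bT: "b \<in> x" "T \<inter> x = {}"
      and VT: "\<And>y. \<lbrakk>y \<in> filters L; b \<in> y; T \<inter> y = {}\<rbrakk> \<Longrightarrow> y \<in> V"
      using Int.IH(2)[OF xUV(2)] by meson
    have "U \<subseteq> filters L"
      using Int.hyps(1) openin_subset[of "topo (S0 L)" U] topspace_S0
      by (simp add: topo_S0 openin_topology_generated_by_iff)
    then have x: "x \<in> filters L"
      using xUV by blast
    then have ab: "a \<in> carr L" "b \<in> carr L"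
      using aS bT filter_subset by auto
    have "(S \<union> T) \<inter> x = {}"
      using aS bT by blast
    moreover have "\<forall>y\<in>filters L. a \<cdot> b \<in> y \<and> (S \<union> T) \<inter> y = {} \<longrightarrow> y \<in> U \<inter> V"
      using US VT ab by (auto simp: filter_meet_iff Int_Un_distrib2)
    moreover have "a \<cdot> b \<in> x"
      using aS bT x by (simp add: filter_meet)
    ultimately show ?case
      by blast
  next
    case (UN K)
    then obtain k where k: "k \<in> K" "x \<in> k"
      by blast
    then obtain a S where "a \<in> x" "S \<inter> x = {}" "\<forall>y\<in>filters L. a \<in> y \<and> S \<inter> y = {} \<longrightarrow> y \<in> k"
      using UN.IH[OF k] by meson
    then show ?case
      using k(1) by (metis UnionI)
  next
    case (Basis s)
    then consider a where "a \<in> carr L" "s = hset L a" | a where "a \<in> carr L" "s = filters L - hset L a"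
      by blast
    then show ?case
    proof cases
      case 1
      then show ?thesis
        using Basis.prems by (intro bexI[of _ a] exI[of _ "{}"]) (auto simp: hset_iff)
    next
      case 2
      \<comment> \<open>The complement of zero lies in every filter and serves as a vacuous positive
        condition.\<close>
      then show ?thesis
        using Basis.prems filter_compl_zero
        by (intro bexI[of _ "\<sim> \<zero>"] exI[of _ "{a}"]) (auto simp: hset_iff)
    qed
  qed simp
qed

text \<open>Each new \<open>d\<close> intersects the orthocomplement with
  \<open>hset L (\<sim> d)\<close>, and \<open>hset_meet\<close> absorbs the intersection into one
  element.\<close>

lemma orth_Union_hset:
  assumes "finite D" "D \<subseteq> carr L"
  shows "\<exists>c\<in>carr L. orth (S0 L) (\<Union> (hset L ` D)) = hset L c"
  using assms
proof (induction D)
  case empty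
  \<comment> \<open>The orthocomplement of the empty union is the whole space, which is
    \<open>hset\<close> of the greatest element.\<close>
  show ?case
    using compl_closed zero_closed hset_compl_zero
    by (intro bexI[of _ "\<sim> \<zero>"]) (auto simp: orth_def)
next
  case (insert d D)
  then obtain c where c: "c \<in> carr L" "orth (S0 L) (\<Union> (hset L ` D)) = hset L c"
    by auto
  have "orth (S0 L) (\<Union> (hset L ` insert d D)) = orth (S0 L) (hset L d) \<inter> hset L c"
    unfolding c(2)[symmetric] by (auto simp: orth_def)
  also have "\<dots> = hset L (\<sim> d \<cdot> c)"
    using insert.prems c(1) by (simp add: orth_hset hset_meet compl_closed)
  finally show ?case
    using insert.prems c(1) by (auto intro!: bexI[of _ "\<sim> d \<cdot> c"] meet_closed compl_closed)
qed

text \<open>An open up-set is a union of sets \<open>h(a)\<close>: a basic neighbourhood of \<open>x\<close> that requires \<open>a \<in> x\<close> and excludes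
  elements outside \<open>x\<close> contains the principal filter of \<open>a\<close>. A clopen one is a finite such union,
  whose orthocomplement is again of the form \<open>h(c)\<close>.\<close>

lemma clopen_stable_S0: "clopen_stable (S0 L) = hset L ` carr L"
proof (intro equalityI subsetI)
  fix U assume "U \<in> hset L ` carr L"
  then obtain a where a: "a \<in> carr L" "U = hset L a"
    by blast
  then have "orth (S0 L) (orth (S0 L) U) = hset L (\<sim> (\<sim> a))"
    by (simp add: orth_hset compl_closed)
  then show "U \<in> clopen_stable (S0 L)"
    using a compl_compl[of a] by (simp add: clopen_stable_def openin_hset closedin_hset)
next
  fix U assume "U \<in> clopen_stable (S0 L)"
  then have op: "openin (topo (S0 L)) U" and cl: "closedin (topo (S0 L)) U"
    and st: "U = orth (S0 L) (orth (S0 L) U)"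
    by (auto simp: clopen_stable_def)
  have UF: "U \<subseteq> filters L"
    using openin_subset[OF op] by simp
  \<comment> \<open>Stability makes \<open>U\<close> an orthocomplement, and orthogonality passes to
    larger filters.\<close>
  have up: "y \<in> U" if "x \<in> U" "x \<subseteq> y" "y \<in> filters L" for x y
  proof -
    have "\<forall>z\<in>orth (S0 L) U. x \<bottom>\<^bsub>S0 L\<^esub> z"
      using st that(1) by (auto simp: orth_def)
    then have "\<forall>z\<in>orth (S0 L) U. y \<bottom>\<^bsub>S0 L\<^esub> z"
      using that by (auto simp: prp_S0)
    then have "y \<in> orth (S0 L) (orth (S0 L) U)"
      unfolding orth_def[of _ "orth (S0 L) U"] using that(3) by simp
    then show ?thesis
      using st by simp
  qed
  define P where "P = {a \<in> carr L. hset L a \<subseteq> U}"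
  have "\<exists>a\<in>P. x \<in> hset L a" if x: "x \<in> U" for x
  proof -
    obtain a S where a: "a \<in> x" "S \<inter> x = {}" "\<forall>y\<in>filters L. a \<in> y \<and> S \<inter> y = {} \<longrightarrow> y \<in> U"
      using openin_S0_nhd[OF op x] by blast
    have aL: "a \<in> carr L" and xF: "x \<in> filters L"
      using a x UF filter_subset by auto
    \<comment> \<open>Being contained in \<open>x\<close>, the filter \<open>above a\<close> also
      misses \<open>S\<close>.\<close>
    have "above a \<in> U"
      using a aL xF above_filter[OF aL] above_self[OF aL] above_subset_iff[OF aL xF] by blast
    then have "hset L a \<subseteq> U"
      using up[of "above a"] aL by (auto simp: hset_iff above_subset_iff)
    then show ?thesis
      using aL a xF by (auto simp: P_def hset_iff)
  qed
  then have "U \<subseteq> \<Union> (hset L ` P)"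
    by blast
  moreover have "compactin (topo (S0 L)) U"
    using cl compact_space_S0 closedin_compact_space by blast
  moreover have "\<And>V. V \<in> hset L ` P \<Longrightarrow> openin (topo (S0 L)) V"
    using openin_hset by (auto simp: P_def)
  ultimately obtain \<F> where F: "finite \<F>" "\<F> \<subseteq> hset L ` P" "U \<subseteq> \<Union>\<F>"
    by (metis compactinD)
  then obtain D where D: "finite D" "D \<subseteq> P" "\<F> = hset L ` D"
    by (meson finite_subset_image)
  have "U = \<Union> (hset L ` D)"
    using D F by (auto simp: P_def)
  then obtain c where c: "c \<in> carr L" "orth (S0 L) U = hset L c"
    using orth_Union_hset[of D] D by (auto simp: P_def)
  then have "U = hset L (\<sim> c)"
    using st orth_hset by simp
  then show "U \<in> hset L ` carr L"
    using c compl_closed by blast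
qed

lemma orthomodular_space_S0: "orthomodular_space (S0 L)"
proof (intro orthomodular_space.intro orthomodular_frame_S0 orthomodular_space_axioms.intro)
  show "topspace (topo (S0 L)) = pts (S0 L)" "compact_space (topo (S0 L))"
    by (simp_all add: compact_space_S0)
  show "U \<inter> V \<in> clopen_stable (S0 L)" if "U \<in> clopen_stable (S0 L)" "V \<in> clopen_stable (S0 L)" for U V
    using that by (auto simp: clopen_stable_S0 meet_closed simp flip: hset_meet)
  show "orth (S0 L) U \<in> clopen_stable (S0 L)" if "U \<in> clopen_stable (S0 L)" for U
    using that by (auto simp: clopen_stable_S0 orth_hset compl_closed)
  show "\<exists>z\<in>Omg (S0 L). U = frm_up (S0 L) z" if "U \<in> clopen_stable (S0 L)" for U
    using that by (auto simp: clopen_stable_S0 principal_filters_eq hset_eq_up)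
  show "\<exists>U\<in>clopen_stable (S0 L). x \<in> U \<and> y \<notin> U"
    if "x \<in> pts (S0 L)" "y \<in> pts (S0 L)" "\<not> x \<preceq>\<^bsub>S0 L\<^esub> y" for x y
    using that filter_subset by (auto simp: clopen_stable_S0 ord_S0 hset_iff)
  show "\<exists>U\<in>clopen_stable (S0 L). x \<in> U \<and> y \<in> orth (S0 L) U"
    if xy: "x \<in> pts (S0 L)" "y \<in> pts (S0 L)" "x \<bottom>\<^bsub>S0 L\<^esub> y" for x y
  proof -
    obtain a where "a \<in> x" "\<sim> a \<in> y"
      using xy(3) by (auto simp: prp_S0)
    then show ?thesis
      using xy(1,2) filter_subset[of x a] by (auto simp: clopen_stable_S0 orth_hset hset_iff intro!: bexI[of _ a])
  qed
qed

end

section \<open>The lattice of clopen stable sets\<close>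

context orthomodular_frame
begin

lemma frm_le_refl: "x \<in> pts X \<Longrightarrow> x \<preceq> x"
  using partial_order by (auto simp: partial_order_on_def preorder_on_def refl_on_def frm_le_def)

lemma frm_le_antisym: "\<lbrakk>x \<preceq> y; y \<preceq> x\<rbrakk> \<Longrightarrow> x = y"
  using partial_order by (auto simp: partial_order_on_def frm_le_def dest: antisymD)

lemma frm_le_trans: "\<lbrakk>x \<preceq> y; y \<preceq> z\<rbrakk> \<Longrightarrow> x \<preceq> z"
  using partial_order by (auto simp: partial_order_on_def preorder_on_def frm_le_def dest: transD)

lemma is_frm_top_top: "is_frm_top X \<omega>"
proof -
  obtain w where w: "is_frm_top X w"
    using ex_top by blast
  then have "v = w" if "is_frm_top X v" for v
    using that frm_le_antisym by (simp add: is_frm_top_def)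
  with w show ?thesis
    unfolding frm_top_def by (rule theI)
qed

lemma top_pts: "\<omega> \<in> pts X"
  using is_frm_top_top by (simp add: is_frm_top_def)

lemma orth_subset: "orth X U \<subseteq> pts X"
  by (auto simp: orth_def)

lemma perp_comm: "\<lbrakk>x \<in> pts X; y \<in> pts X\<rbrakk> \<Longrightarrow> x \<bottom> y \<longleftrightarrow> y \<bottom> x"
  by (metis perp_sym)

lemma orth_antimono: "U \<subseteq> V \<Longrightarrow> orth X V \<subseteq> orth X U"
  by (auto simp: orth_def)

lemma top_orth: "U \<subseteq> pts X \<Longrightarrow> \<omega> \<in> orth X U"
  using top_pts perp_top perp_sym by (auto simp: orth_def)

lemma orth_top: "orth X {\<omega>} = pts X"
  using perp_top by (auto simp: orth_def)

text \<open>A point orthogonal to all points is orthogonal to itself.\<close>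

lemma orth_pts: "orth X (pts X) = {\<omega>}"
  using perp_self top_orth[of "pts X"] by (auto simp: orth_def)

lemma Int_orth: "U \<subseteq> pts X \<Longrightarrow> U \<inter> orth X U \<subseteq> {\<omega>}"
  using perp_self by (auto simp: orth_def)

lemma frm_up_mono: "\<lbrakk>x \<in> frm_up X z; x \<preceq> y; y \<in> pts X\<rbrakk> \<Longrightarrow> y \<in> frm_up X z"
  by (auto simp: frm_up_def intro: frm_le_trans)

end

section \<open>Clopen stable sets and the orthomodular law\<close>

locale plain_oms = orthomodular_space X for X :: "'x ortho_space" (structure)
begin

lemma stable_orth_orth: "U \<in> clopen_stable X \<Longrightarrow> orth X (orth X U) = U"
  by (simp add: clopen_stable_def)

lemma stable_subset: "U \<in> clopen_stable X \<Longrightarrow> U \<subseteq> pts X"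
  using orth_subset[of "orth X U"] by (simp add: stable_orth_orth)

lemma stable_mono: "\<lbrakk>U \<in> clopen_stable X; x \<in> U; x \<preceq> y; y \<in> pts X\<rbrakk> \<Longrightarrow> y \<in> U"
  by (drule stable_up) (auto intro: frm_up_mono)

text \<open>The whole space and \<open>{\<omega>}\<close> are orthocomplements of each other. Since
  the space is clopen in itself, closure under orthocomplements then makes \<open>{\<omega>}\<close>
  clopen as well, as the zero of \<open>A0 X\<close> has to be.\<close>

lemma pts_stable: "pts X \<in> clopen_stable X"
  using openin_topspace[of "topo X"] closedin_topspace[of "topo X"]
  by (simp add: clopen_stable_def orth_pts orth_top topspace_eq)

lemma top_stable: "{\<omega>} \<in> clopen_stable X"
  using stable_orth[OF pts_stable] by (simp add: orth_pts)

lemma top_in_stable: "U \<in> clopen_stable X \<Longrightarrow> \<omega> \<in> U"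
  using top_orth[OF orth_subset[of U]] by (simp add: stable_orth_orth)

text \<open>This is the orthomodular law in the form without joins.
  \<open>Omega_orthomodular\<close> is applied to the generators \<open>u\<close> and
  \<open>v\<close>: a point above \<open>u\<close> and orthogonal to \<open>v\<close> lies in
  \<open>U\<close> and in the orthocomplement of \<open>V\<close>.\<close>

lemma clopen_stable_eqI:
  assumes U: "U \<in> clopen_stable X" and V: "V \<in> clopen_stable X" and "V \<subseteq> U"
    and orth: "U \<inter> orth X V \<subseteq> {\<omega>}"
  shows "U = V"
proof -
  obtain u v where u: "u \<in> Omg X" "U = frm_up X u" and v: "v \<in> Omg X" "V = frm_up X v"
    using stable_up U V by metis
  have pts: "u \<in> pts X" "v \<in> pts X"
    using u v Omega_subset by auto
  have "v \<in> U"
    using \<open>V \<subseteq> U\<close> frm_le_refl pts v by (auto simp: frm_up_def)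
  then have "u \<preceq> v"
    using u by (simp add: frm_up_def)
  moreover have "z = \<omega>" if z: "z \<in> pts X" "u \<preceq> z" "z \<bottom> v" for z
  proof -
    \<comment> \<open>\<open>v\<close> is the least element of \<open>V\<close>, so orthogonality to
      \<open>v\<close> spreads over \<open>V\<close>.\<close>
    have "z \<bottom> y" if "y \<in> V" for y
    proof -
      have "y \<in> pts X" "v \<preceq> y"
        using that v by (auto simp: frm_up_def)
      then show ?thesis
        using z pts perp_mono perp_sym by metis
    qed
    then have "z \<in> U \<inter> orth X V"
      using z u by (auto simp: frm_up_def orth_def)
    then show ?thesis
      using orth by blast
  qed
  ultimately have "v = u"
    using Omega_orthomodular[OF v(1) u(1)] by blast
  then show ?thesis
    using u v by simp
qed

lemma A0_simps [simp]:
  "carr (A0 X) = clopen_stable X" "U \<cdot>\<^bsub>A0 X\<^esub> V = U \<inter> V" "\<sim>\<^bsub>A0 X\<^esub> U = orth X U" "\<zero>\<^bsub>A0 X\<^esub> = {\<omega>}"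
  by (simp_all add: A0_def)

lemma le_A0: "U \<sqsubseteq>\<^bsub>A0 X\<^esub> V \<longleftrightarrow> U \<subseteq> V"
  by (auto simp: alg_le_def)

lemma orthomodular_lattice_A0: "orthomodular_lattice (A0 X)"
proof (unfold_locales, goal_cases)
  case (10 U)
  then show ?case
    by (simp add: stable_orth_orth)
next
  case (9 U V)
  then show ?case
    by (simp add: le_A0 orth_antimono)
next
  case (8 U)
  then show ?case
    using Int_orth[of U] stable_subset top_in_stable[of U] top_in_stable[OF stable_orth[of U]] by auto
next
  case (11 U V)
  then have UV: "U \<in> clopen_stable X" "V \<in> clopen_stable X" "U \<subseteq> V"
    by (auto simp: le_A0)
  let ?C = "orth X U \<inter> V"
  \<comment> \<open>This is the join of \<open>U\<close> and \<open>?C\<close> written out. The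
    intersection of \<open>V\<close> with its orthocomplement is that of \<open>?C\<close> with the
    orthocomplement of \<open>?C\<close>, hence trivial.\<close>
  let ?W = "orth X (orth X U \<inter> orth X ?C)"
  have C: "?C \<in> clopen_stable X" and W: "?W \<in> clopen_stable X"
    using UV by (simp_all add: stable_orth stable_Int)
  have "orth X V \<subseteq> orth X U \<inter> orth X ?C"
    using orth_antimono[OF UV(3)] orth_antimono[of ?C V] by auto
  then have "?W \<subseteq> V"
    using orth_antimono stable_orth_orth[OF UV(2)] by metis
  moreover have "orth X ?W = orth X U \<inter> orth X ?C"
    using UV C by (simp add: stable_orth_orth stable_orth stable_Int)
  then have "V \<inter> orth X ?W \<subseteq> {\<omega>}"
    using Int_orth[OF stable_subset[OF C]] by auto
  ultimately have "V = ?W"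
    using clopen_stable_eqI UV(2) W by blast
  then show ?case
    by (simp add: alg_join_def)
qed (auto simp: le_A0 stable_Int stable_orth top_stable top_in_stable)

lemma plain_oml_A0: "plain_oml (A0 X)"
  by (simp add: plain_oml_def orthomodular_lattice_A0)

end

section \<open>Functoriality\<close>

lemma oml_hom_id: "orthomodular_lattice A \<Longrightarrow> (\<lambda>a\<in>carr A. a) \<in> oml_hom A A"
proof -
  assume "orthomodular_lattice A"
  then interpret orthomodular_lattice A .
  show ?thesis
    by (simp add: oml_hom_def meet_closed compl_closed zero_closed)
qed

lemma oml_homD:
  assumes "\<phi> \<in> oml_hom A B"
  shows "a \<in> carr A \<Longrightarrow> \<phi> a \<in> carr B"
    and "\<lbrakk>a \<in> carr A; b \<in> carr A\<rbrakk> \<Longrightarrow> \<phi> (a \<cdot>\<^bsub>A\<^esub> b) = \<phi> a \<cdot>\<^bsub>B\<^esub> \<phi> b"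
    and "a \<in> carr A \<Longrightarrow> \<phi> (\<sim>\<^bsub>A\<^esub> a) = \<sim>\<^bsub>B\<^esub> (\<phi> a)"
    and "\<phi> \<zero>\<^bsub>A\<^esub> = \<zero>\<^bsub>B\<^esub>"
  using assms by (auto simp: oml_hom_def)

lemma oml_hom_compose:
  assumes "orthomodular_lattice A" and \<phi>: "\<phi> \<in> oml_hom A B" and \<rho>: "\<rho> \<in> oml_hom B C"
  shows "compose (carr A) \<rho> \<phi> \<in> oml_hom A C"
proof -
  interpret orthomodular_lattice A by fact
  show ?thesis
    unfolding oml_hom_def
    by (auto simp: compose_def oml_homD[OF \<phi>] oml_homD[OF \<rho>] meet_closed compl_closed zero_closed)
qed

lemma oms_homD:
  assumes "\<psi> \<in> oms_hom X Y"
  shows "x \<in> pts X \<Longrightarrow> \<psi> x \<in> pts Y"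
    and "continuous_map (topo X) (topo Y) \<psi>"
    and "\<lbrakk>x \<in> pts X; y \<in> pts X; \<psi> x \<bottom>\<^bsub>Y\<^esub> \<psi> y\<rbrakk> \<Longrightarrow> x \<bottom>\<^bsub>X\<^esub> y"
    and "\<lbrakk>z \<in> pts Y; y \<in> pts X; \<not> z \<bottom>\<^bsub>Y\<^esub> \<psi> y\<rbrakk> \<Longrightarrow> \<exists>x\<in>pts X. \<not> x \<bottom>\<^bsub>X\<^esub> y \<and> z \<preceq>\<^bsub>Y\<^esub> \<psi> x"
  using assms unfolding oms_hom_def by blast+

lemma oms_hom_id: "orthomodular_space X \<Longrightarrow> (\<lambda>x\<in>pts X. x) \<in> oms_hom X X"
proof -
  assume "orthomodular_space X"
  then interpret orthomodular_space X .
  have "continuous_map (topo X) (topo X) (\<lambda>x\<in>pts X. x)"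
    by (rule continuous_map_eq[OF continuous_map_id]) (simp add: topspace_eq)
  then show ?thesis
    using frm_le_refl by (auto simp: oms_hom_def)
qed

section \<open>Preimages of clopen stable sets under weak p-morphisms\<close>

locale oms_pair = X: plain_oms X + Y: plain_oms Y
  for X :: "'x ortho_space" and Y :: "'y ortho_space" +
  fixes \<psi> assumes hom: "\<psi> \<in> oms_hom X Y"
begin

abbreviation preim :: "'y set \<Rightarrow> 'x set" where
  "preim U \<equiv> {x \<in> pts X. \<psi> x \<in> U}"

text \<open>Each condition on weak p-morphisms gives one inclusion. For the second, a point
  \<open>u\<close> of \<open>U\<close> not orthogonal to \<open>\<psi> x\<close> yields a
  \<open>w\<close> not orthogonal to \<open>x\<close> with \<open>\<psi> w\<close> above
  \<open>u\<close>; as \<open>U\<close> is an up-set, \<open>w\<close> lies in the preimage.\<close>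

lemma orth_preim:
  assumes U: "U \<in> clopen_stable Y"
  shows "preim (orth Y U) = orth X (preim U)"
proof (intro equalityI subsetI)
  fix x assume "x \<in> preim (orth Y U)"
  then show "x \<in> orth X (preim U)"
    using oms_homD(3)[OF hom] by (auto simp: orth_def)
next
  fix x assume x: "x \<in> orth X (preim U)"
  then have xX: "x \<in> pts X"
    by (simp add: orth_def)
  have "\<psi> x \<bottom>\<^bsub>Y\<^esub> u" if u: "u \<in> U" for u
  proof (rule ccontr)
    have uY: "u \<in> pts Y"
      using u U Y.stable_subset by auto
    assume "\<not> \<psi> x \<bottom>\<^bsub>Y\<^esub> u"
    then have "\<not> u \<bottom>\<^bsub>Y\<^esub> \<psi> x"
      using uY xX oms_homD(1)[OF hom] Y.perp_comm by metis
    then obtain w where w: "w \<in> pts X" "\<not> w \<bottom>\<^bsub>X\<^esub> x" "u \<preceq>\<^bsub>Y\<^esub> \<psi> w"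
      using oms_homD(4)[OF hom uY xX] by blast
    then have "w \<in> preim U"
      using Y.stable_mono[OF U u] oms_homD(1)[OF hom] by auto
    then have "x \<bottom>\<^bsub>X\<^esub> w"
      using x by (auto simp: orth_def)
    then show False
      using w X.perp_comm xX by metis
  qed
  then show "x \<in> preim (orth Y U)"
    using xX oms_homD(1)[OF hom] by (auto simp: orth_def)
qed

lemma preim_stable:
  assumes U: "U \<in> clopen_stable Y"
  shows "preim U \<in> clopen_stable X"
proof -
  have "orth X (orth X (preim U)) = preim (orth Y (orth Y U))"
    using U by (simp add: orth_preim Y.stable_orth del: mem_Collect_eq)
  moreover have "openin (topo X) (preim U)" "closedin (topo X) (preim U)"
    using U oms_homD(2)[OF hom] openin_continuous_map_preimage closedin_continuous_map_preimage
    unfolding clopen_stable_def X.topspace_eq[symmetric] by blast+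
  ultimately show ?thesis
    using U by (simp add: clopen_stable_def)
qed

lemma hom_mono:
  assumes "x \<in> pts X" "y \<in> pts X" "x \<preceq>\<^bsub>X\<^esub> y"
  shows "\<psi> x \<preceq>\<^bsub>Y\<^esub> \<psi> y"
proof (rule ccontr)
  assume "\<not> \<psi> x \<preceq>\<^bsub>Y\<^esub> \<psi> y"
  then obtain U where U: "U \<in> clopen_stable Y" "\<psi> x \<in> U" "\<psi> y \<notin> U"
    using Y.separate_le assms oms_homD(1)[OF hom] by metis
  then have "y \<in> preim U"
    using assms by (intro X.stable_mono[OF preim_stable[OF U(1)] _ assms(3)]) auto
  with U show False
    by simp
qed

lemma A1_hom: "A1 X Y \<psi> \<in> oml_hom (A0 Y) (A0 X)"
proof -
  \<comment> \<open>Zero is the orthocomplement of the whole space, so its preservation is an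
    instance of \<open>orth_preim\<close>.\<close>
  have "preim {\<omega>\<^bsub>Y\<^esub>} = {\<omega>\<^bsub>X\<^esub>}"
  proof -
    have "preim (orth Y (pts Y)) = orth X (preim (pts Y))"
      by (rule orth_preim[OF Y.pts_stable])
    also have "preim (pts Y) = pts X"
      using oms_homD(1)[OF hom] by auto
    finally show ?thesis
      by (simp add: X.orth_pts Y.orth_pts)
  qed
  then show ?thesis
    unfolding oml_hom_def A1_def
    by (auto simp: preim_stable orth_preim Y.stable_orth Y.stable_Int Y.top_stable)
qed

end

lemma oms_pairI:
  "\<lbrakk>orthomodular_space X; orthomodular_space Y; \<psi> \<in> oms_hom X Y\<rbrakk> \<Longrightarrow> oms_pair X Y \<psi>"
  by (simp add: oms_pair_def plain_oms_def oms_pair_axioms_def)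

lemma oms_hom_compose:
  assumes X: "orthomodular_space X" and Y: "orthomodular_space Y" and Z: "orthomodular_space Z"
    and \<psi>: "\<psi> \<in> oms_hom X Y" and \<theta>: "\<theta> \<in> oms_hom Y Z"
  shows "compose (pts X) \<theta> \<psi> \<in> oms_hom X Z"
proof -
  interpret Z: orthomodular_space Z by fact
  interpret X: orthomodular_space X by fact
  interpret YZ: oms_pair Y Z \<theta>
    using Y Z \<theta> by (rule oms_pairI)
  have "continuous_map (topo X) (topo Z) (compose (pts X) \<theta> \<psi>)"
    by (rule continuous_map_eq[OF continuous_map_compose[OF oms_homD(2)[OF \<psi>] oms_homD(2)[OF \<theta>]]])
      (simp add: X.topspace_eq compose_def)
  moreover have "\<exists>x\<in>pts X. \<not> x \<bottom>\<^bsub>X\<^esub> y \<and> z \<preceq>\<^bsub>Z\<^esub> \<theta> (\<psi> x)"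
    if z: "z \<in> pts Z" and y: "y \<in> pts X" and np: "\<not> z \<bottom>\<^bsub>Z\<^esub> \<theta> (\<psi> y)" for y z
  proof -
    obtain u where u: "u \<in> pts Y" "\<not> u \<bottom>\<^bsub>Y\<^esub> \<psi> y" "z \<preceq>\<^bsub>Z\<^esub> \<theta> u"
      using oms_homD(4)[OF \<theta> z oms_homD(1)[OF \<psi> y] np] by blast
    obtain x where x: "x \<in> pts X" "\<not> x \<bottom>\<^bsub>X\<^esub> y" "u \<preceq>\<^bsub>Y\<^esub> \<psi> x"
      using oms_homD(4)[OF \<psi> u(1) y u(2)] by blast
    \<comment> \<open>The back condition only places \<open>u\<close> below \<open>\<psi> x\<close>,
      without equality; monotonicity of \<open>\<theta>\<close> carries this inequality to
      \<open>Z\<close>.\<close>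
    then have "\<theta> u \<preceq>\<^bsub>Z\<^esub> \<theta> (\<psi> x)"
      using YZ.hom_mono[OF u(1)] oms_homD(1)[OF \<psi>] by blast
    then show ?thesis
      using x u(3) Z.frm_le_trans by blast
  qed
  ultimately show ?thesis
    using oms_homD(1,3)[OF \<psi>] oms_homD(1,3)[OF \<theta>] by (auto simp: oms_hom_def compose_def)
qed

lemma S1_id: "S1 A A (\<lambda>a\<in>carr A. a) = (\<lambda>x\<in>pts (S0 A). x)"
  unfolding S1_def pts_S0 by (rule restrict_ext) (auto simp: filters_def)

section \<open>Preimages of filters under homomorphisms\<close>

locale oml_pair = A: plain_oml A + B: plain_oml B
  for A :: "'a ortho_alg" and B :: "'b ortho_alg" +
  fixes \<phi> assumes hom: "\<phi> \<in> oml_hom A B"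
begin

lemma hom_mono: "\<lbrakk>a \<in> carr A; b \<in> carr A; a \<sqsubseteq>\<^bsub>A\<^esub> b\<rbrakk> \<Longrightarrow> \<phi> a \<sqsubseteq>\<^bsub>B\<^esub> \<phi> b"
  unfolding alg_le_def using oml_homD(2)[OF hom] by metis

lemma hom_compl_zero: "\<phi> (\<sim>\<^bsub>A\<^esub> \<zero>\<^bsub>A\<^esub>) = \<sim>\<^bsub>B\<^esub> \<zero>\<^bsub>B\<^esub>"
  by (simp add: oml_homD[OF hom] A.zero_closed)

lemma preim_filter:
  assumes x: "x \<in> filters B"
  shows "{a \<in> carr A. \<phi> a \<in> x} \<in> filters A"
proof (rule A.filterI)
  show "\<sim>\<^bsub>A\<^esub> \<zero>\<^bsub>A\<^esub> \<in> {a \<in> carr A. \<phi> a \<in> x}"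
    using x by (simp add: A.compl_closed A.zero_closed hom_compl_zero B.filter_compl_zero)
  show "b \<in> {a \<in> carr A. \<phi> a \<in> x}" if "a \<in> {a \<in> carr A. \<phi> a \<in> x}" "b \<in> carr A" "a \<sqsubseteq>\<^bsub>A\<^esub> b" for a b
    using that B.filter_up[OF x _ hom_mono[OF _ that(2,3)] oml_homD(1)[OF hom that(2)]] by simp
qed (auto simp: A.meet_closed oml_homD[OF hom] B.filter_meet[OF x])

lemma S1_hom: "S1 A B \<phi> \<in> oms_hom (S0 B) (S0 A)"
proof -
  have vimage: "S1 A B \<phi> -` hset A a \<inter> filters B = hset B (\<phi> a)" if "a \<in> carr A" for a
    using that by (auto simp: S1_def A.hset_iff B.hset_iff preim_filter)
  have cont: "continuous_map (topo (S0 B)) (topo (S0 A)) (S1 A B \<phi>)"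
    unfolding topo_S0[of A]
  proof (rule continuous_on_generated_topo)
    fix U assume "U \<in> hset A ` carr A \<union> (\<lambda>a. filters A - hset A a) ` carr A"
    then consider a where "a \<in> carr A" "U = hset A a" | a where "a \<in> carr A" "U = filters A - hset A a"
      by blast
    then show "openin (topo (S0 B)) (S1 A B \<phi> -` U \<inter> topspace (topo (S0 B)))"
    proof cases
      case 1
      then show ?thesis
        by (simp add: vimage oml_homD(1)[OF hom] B.openin_hset)
    next
      case 2
      then have "S1 A B \<phi> -` U \<inter> filters B = filters B - hset B (\<phi> a)"
        unfolding vimage[OF 2(1), symmetric] by (auto simp: S1_def preim_filter)
      then show ?thesis
        using 2 B.closedin_hset[OF oml_homD(1)[OF hom]] by (simp add: closedin_def)
    qed
  next
    show "S1 A B \<phi> ` topspace (topo (S0 B)) \<subseteq> \<Union> (hset A ` carr A \<union> (\<lambda>a. filters A - hset A a) ` carr A)"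
      using A.topspace_S0 preim_filter by (auto simp: topo_S0[of A] S1_def)
  qed
  have "\<exists>x\<in>filters B. \<not> x \<bottom>\<^bsub>S0 B\<^esub> y \<and> z \<preceq>\<^bsub>S0 A\<^esub> {a \<in> carr A. \<phi> a \<in> x}"
    if z: "z \<in> filters A" and y: "y \<in> filters B" and np: "\<not> z \<bottom>\<^bsub>S0 A\<^esub> {a \<in> carr A. \<phi> a \<in> y}" for y z
  proof -
    \<comment> \<open>This is the filter generated by the image of \<open>z\<close>. It is the least
      filter whose preimage contains \<open>z\<close>, and smaller filters are orthogonal to fewer
      filters, so it is the best candidate.\<close>
    define x where "x = {b \<in> carr B. \<exists>a\<in>z. \<phi> a \<sqsubseteq>\<^bsub>B\<^esub> b}"
    have zA: "a \<in> carr A" if "a \<in> z" for a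
      using A.filter_subset z that by blast
    have x: "x \<in> filters B"
    proof (rule B.filterI)
      show "\<sim>\<^bsub>B\<^esub> \<zero>\<^bsub>B\<^esub> \<in> x"
        using A.filter_compl_zero[OF z] B.le_compl_zero[of "\<sim>\<^bsub>B\<^esub> \<zero>\<^bsub>B\<^esub>"] hom_compl_zero
        by (auto simp: x_def B.compl_closed B.zero_closed intro!: bexI[of _ "\<sim>\<^bsub>A\<^esub> \<zero>\<^bsub>A\<^esub>"])
      show "c \<in> x" if "b \<in> x" "c \<in> carr B" "b \<sqsubseteq>\<^bsub>B\<^esub> c" for b c
        using that B.le_trans[OF _ _ _ _ that(3)] oml_homD(1)[OF hom] zA unfolding x_def by blast
      show "b \<cdot>\<^bsub>B\<^esub> c \<in> x" if bc: "b \<in> x" "c \<in> x" for b c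
      proof -
        obtain a d where ad: "a \<in> z" "\<phi> a \<sqsubseteq>\<^bsub>B\<^esub> b" "d \<in> z" "\<phi> d \<sqsubseteq>\<^bsub>B\<^esub> c"
          using bc by (auto simp: x_def)
        have "\<phi> (a \<cdot>\<^bsub>A\<^esub> d) \<sqsubseteq>\<^bsub>B\<^esub> b \<cdot>\<^bsub>B\<^esub> c"
          using ad bc zA oml_homD(1)[OF hom] by (auto simp: oml_homD(2)[OF hom] x_def intro: B.meet_mono)
        then show ?thesis
          using ad bc A.filter_meet[OF z] by (auto simp: x_def B.meet_closed)
      qed
    qed (auto simp: x_def)
    \<comment> \<open>A witness of orthogonality between \<open>x\<close> and \<open>y\<close> lies
      above some \<open>\<phi> a\<close> with \<open>a \<in> z\<close>; then \<open>a\<close>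
      witnesses that \<open>z\<close> is orthogonal to the preimage of \<open>y\<close>.\<close>
    have "\<not> x \<bottom>\<^bsub>S0 B\<^esub> y"
    proof
      assume "x \<bottom>\<^bsub>S0 B\<^esub> y"
      then obtain a b where ab: "a \<in> z" "b \<in> carr B" "\<phi> a \<sqsubseteq>\<^bsub>B\<^esub> b" "\<sim>\<^bsub>B\<^esub> b \<in> y"
        by (auto simp: prp_S0 x_def)
      then have "\<sim>\<^bsub>B\<^esub> b \<sqsubseteq>\<^bsub>B\<^esub> \<phi> (\<sim>\<^bsub>A\<^esub> a)"
        using zA by (simp add: oml_homD[OF hom] B.compl_antitone)
      then have "\<phi> (\<sim>\<^bsub>A\<^esub> a) \<in> y"
        using B.filter_up[OF y ab(4)] zA[OF ab(1)] by (simp add: oml_homD[OF hom] A.compl_closed B.compl_closed)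
      then have "z \<bottom>\<^bsub>S0 A\<^esub> {a \<in> carr A. \<phi> a \<in> y}"
        using ab(1) A.compl_closed[OF zA[OF ab(1)]] z preim_filter[OF y]
        by (auto simp: prp_S0 intro!: bexI[of _ a])
      then show False
        using np by simp
    qed
    moreover have "z \<subseteq> {a \<in> carr A. \<phi> a \<in> x}"
    proof
      fix a assume "a \<in> z"
      then show "a \<in> {a \<in> carr A. \<phi> a \<in> x}"
        using zA B.le_refl[of "\<phi> a"] by (auto simp: x_def oml_homD(1)[OF hom])
    qed
    ultimately show ?thesis
      using x z preim_filter by (auto simp: ord_S0)
  qed
  moreover have "x \<bottom>\<^bsub>S0 B\<^esub> y"
    if xy: "x \<in> filters B" "y \<in> filters B" and p: "{a \<in> carr A. \<phi> a \<in> x} \<bottom>\<^bsub>S0 A\<^esub> {a \<in> carr A. \<phi> a \<in> y}" for x y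
  proof -
    obtain a where "a \<in> carr A" "\<phi> a \<in> x" "\<phi> (\<sim>\<^bsub>A\<^esub> a) \<in> y"
      using p by (auto simp: prp_S0)
    then show ?thesis
      using xy by (auto simp: prp_S0 oml_homD[OF hom])
  qed
  moreover have "S1 A B \<phi> \<in> filters B \<rightarrow>\<^sub>E filters A"
    by (auto simp: S1_def preim_filter)
  ultimately show ?thesis
    using cont unfolding oms_hom_def pts_S0 by (auto simp: S1_def)
qed

end

lemma oml_pairI:
  "\<lbrakk>orthomodular_lattice A; orthomodular_lattice B; \<phi> \<in> oml_hom A B\<rbrakk> \<Longrightarrow> oml_pair A B \<phi>"
  by (simp add: oml_pair_def plain_oml_def oml_pair_axioms_def)

lemma S1_compose:
  assumes "orthomodular_lattice B" "orthomodular_lattice C" "\<phi> \<in> oml_hom A B" and \<rho>: "\<rho> \<in> oml_hom B C"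
  shows "S1 A C (compose (carr A) \<rho> \<phi>) = compose (pts (S0 C)) (S1 A B \<phi>) (S1 B C \<rho>)"
proof -
  interpret oml_pair B C \<rho>
    using assms by (simp add: oml_pairI)
  show ?thesis
    using oml_homD(1)[OF assms(3)] preim_filter
    by (auto simp: S1_def compose_def fun_eq_iff)
qed

lemma A1_compose:
  assumes "orthomodular_space Y" "orthomodular_space Z" "\<psi> \<in> oms_hom X Y" and \<theta>: "\<theta> \<in> oms_hom Y Z"
  shows "A1 X Z (compose (pts X) \<theta> \<psi>) = compose (carr (A0 Z)) (A1 X Y \<psi>) (A1 Y Z \<theta>)"
proof -
  interpret oms_pair Y Z \<theta>
    using assms by (simp add: oms_pairI)
  show ?thesis
    using oms_homD(1)[OF assms(3)] preim_stable
    by (auto simp: A1_def compose_def fun_eq_iff)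
qed

lemma (in plain_oms) A1_id: "A1 X X (\<lambda>x\<in>pts X. x) = (\<lambda>U\<in>carr (A0 X). U)"
  unfolding A1_def A0_simps by (rule restrict_ext) (use stable_subset in auto)

section \<open>Natural isomorphisms\<close>

text \<open>As for algebras in general, the inverse of a bijective homomorphism preserves the
  operations: compute in \<open>A\<close>, map by \<open>\<phi>\<close>, and cancel
  \<open>\<phi>'\<close> against \<open>\<phi>\<close>.\<close>

lemma oml_isoI:
  assumes "orthomodular_lattice A" and \<phi>: "\<phi> \<in> oml_hom A B" and bij: "bij_betw \<phi> (carr A) (carr B)"
  shows "\<phi> \<in> oml_iso A B"
proof -
  interpret orthomodular_lattice A by fact
  define \<phi>' where "\<phi>' = (\<lambda>b\<in>carr B. inv_into (carr A) \<phi> b)"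
  have inv1: "\<phi>' (\<phi> a) = a" if "a \<in> carr A" for a
    using that bij oml_homD(1)[OF \<phi>] by (simp add: \<phi>'_def bij_betw_inv_into_left)
  have inv2: "\<phi> (\<phi>' b) = b" if "b \<in> carr B" for b
    using that bij by (simp add: \<phi>'_def bij_betw_inv_into_right)
  have closed: "\<phi>' b \<in> carr A" if "b \<in> carr B" for b
    using that bij by (simp add: \<phi>'_def bij_betw_def inv_into_into)
  have "\<phi>' (b \<cdot>\<^bsub>B\<^esub> c) = \<phi>' b \<cdot>\<^bsub>A\<^esub> \<phi>' c" if "b \<in> carr B" "c \<in> carr B" for b c
    using inv1[of "\<phi>' b \<cdot>\<^bsub>A\<^esub> \<phi>' c"] that by (simp add: closed meet_closed oml_homD(2)[OF \<phi>] inv2)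
  moreover have "\<phi>' (\<sim>\<^bsub>B\<^esub> b) = \<sim>\<^bsub>A\<^esub> (\<phi>' b)" if "b \<in> carr B" for b
    using inv1[of "\<sim>\<^bsub>A\<^esub> (\<phi>' b)"] that by (simp add: closed compl_closed oml_homD(3)[OF \<phi>] inv2)
  moreover have "\<phi>' \<zero>\<^bsub>B\<^esub> = \<zero>\<^bsub>A\<^esub>"
    using inv1[OF zero_closed] by (simp add: oml_homD(4)[OF \<phi>])
  moreover have "\<phi>' \<in> carr B \<rightarrow>\<^sub>E carr A"
    using closed by (auto simp: \<phi>'_def)
  ultimately have "\<phi>' \<in> oml_hom B A"
    by (simp add: oml_hom_def)
  moreover have "compose (carr A) \<phi>' \<phi> = (\<lambda>a\<in>carr A. a)" "compose (carr B) \<phi> \<phi>' = (\<lambda>b\<in>carr B. b)"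
    unfolding compose_def by (rule restrict_ext, simp add: inv1 inv2)+
  ultimately show ?thesis
    using \<phi> unfolding oml_iso_def by blast
qed

lemma (in plain_oml) eta_iso: "eta L \<in> oml_iso L (A0 (S0 L))"
proof (rule oml_isoI)
  interpret S: plain_oms "S0 L"
    by (simp add: plain_oms_def orthomodular_space_S0)
  show "orthomodular_lattice L"
    by unfold_locales
  show "eta L \<in> oml_hom L (A0 (S0 L))"
    unfolding oml_hom_def
    by (auto simp: eta_def clopen_stable_S0 meet_closed compl_closed zero_closed hset_meet orth_hset
        hset_zero top_S0)
  show "bij_betw (eta L) (carr L) (carr (A0 (S0 L)))"
    using hset_inj by (simp add: bij_betw_def eta_def clopen_stable_S0 inj_on_def)
qed

text \<open>Both sides send \<open>a\<close> to the set of filters of \<open>B\<close> that contain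
  \<open>\<phi> a\<close>.\<close>

lemma (in oml_pair) eta_natural:
  "compose (carr A) (A1 (S0 B) (S0 A) (S1 A B \<phi>)) (eta A) = compose (carr A) (eta B) \<phi>"
  unfolding compose_def
proof (rule restrict_ext)
  fix a assume a: "a \<in> carr A"
  then have "hset A a \<in> clopen_stable (S0 A)"
    by (simp add: A.clopen_stable_S0)
  then show "A1 (S0 B) (S0 A) (S1 A B \<phi>) (eta A a) = eta B (\<phi> a)"
    using a oml_homD(1)[OF hom a] preim_filter
    by (auto simp: A1_def S1_def eta_def A.hset_iff B.hset_iff)
qed

text \<open>For a bijection, being a weak p-morphism in both directions only depends on the orthogonality
  relation.\<close>

lemma oms_homI:
  assumes "orthomodular_frame Y" "\<psi> \<in> pts X \<rightarrow>\<^sub>E pts Y" "continuous_map (topo X) (topo Y) \<psi>"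
    and surj: "pts Y \<subseteq> \<psi> ` pts X"
    and perp: "\<And>x y. \<lbrakk>x \<in> pts X; y \<in> pts X\<rbrakk> \<Longrightarrow> \<psi> x \<bottom>\<^bsub>Y\<^esub> \<psi> y \<longleftrightarrow> x \<bottom>\<^bsub>X\<^esub> y"
  shows "\<psi> \<in> oms_hom X Y"
proof -
  interpret orthomodular_frame Y by fact
  have "\<exists>x\<in>pts X. \<not> x \<bottom>\<^bsub>X\<^esub> y \<and> z \<preceq>\<^bsub>Y\<^esub> \<psi> x"
    if z: "z \<in> pts Y" "y \<in> pts X" "\<not> z \<bottom>\<^bsub>Y\<^esub> \<psi> y" for y z
  proof -
    obtain x where "x \<in> pts X" "z = \<psi> x"
      using z(1) surj by blast
    then show ?thesis
      using z perp frm_le_refl by auto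
  qed
  then show ?thesis
    using assms(2,3) perp by (simp add: oms_hom_def)
qed

lemma oms_isoI:
  assumes X: "orthomodular_space X" and Y: "orthomodular_space Y" and fn: "\<psi> \<in> pts X \<rightarrow>\<^sub>E pts Y"
    and hom: "homeomorphic_map (topo X) (topo Y) \<psi>"
    and perp: "\<And>x y. \<lbrakk>x \<in> pts X; y \<in> pts X\<rbrakk> \<Longrightarrow> \<psi> x \<bottom>\<^bsub>Y\<^esub> \<psi> y \<longleftrightarrow> x \<bottom>\<^bsub>X\<^esub> y"
  shows "\<psi> \<in> oms_iso X Y"
proof -
  interpret X: orthomodular_space X by fact
  interpret Y: orthomodular_space Y by fact
  obtain g where g: "continuous_map (topo X) (topo Y) \<psi>" "continuous_map (topo Y) (topo X) g"
    "\<And>x. x \<in> pts X \<Longrightarrow> g (\<psi> x) = x" "\<And>y. y \<in> pts Y \<Longrightarrow> \<psi> (g y) = y"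
    using hom unfolding homeomorphic_map_maps homeomorphic_maps_def X.topspace_eq Y.topspace_eq by blast
  \<comment> \<open>The topological inverse \<open>g\<close> is arbitrary off \<open>pts Y\<close>;
    arrows have to be extensional.\<close>
  define \<psi>' where "\<psi>' = restrict g (pts Y)"
  have gY: "g y \<in> pts X" if "y \<in> pts Y" for y
    using continuous_map_image_subset_topspace[OF g(2)] that by (auto simp: X.topspace_eq Y.topspace_eq)
  have "\<psi> \<in> oms_hom X Y"
  proof (rule oms_homI[OF Y.orthomodular_frame_axioms fn g(1) _ perp])
    show "pts Y \<subseteq> \<psi> ` pts X"
      using g(4) gY by (metis image_eqI subsetI)
  qed
  moreover have "\<psi>' \<in> oms_hom Y X"
  proof (rule oms_homI[OF X.orthomodular_frame_axioms])
    show "\<psi>' \<in> pts Y \<rightarrow>\<^sub>E pts X"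
      using gY by (auto simp: \<psi>'_def)
    show "continuous_map (topo Y) (topo X) \<psi>'"
      by (rule continuous_map_eq[OF g(2)]) (simp add: \<psi>'_def Y.topspace_eq)
    show "pts X \<subseteq> \<psi>' ` pts Y"
    proof
      fix x assume x: "x \<in> pts X"
      then have "\<psi> x \<in> pts Y"
        using fn by auto
      then show "x \<in> \<psi>' ` pts Y"
        using g(3)[OF x] by (intro image_eqI[of _ _ "\<psi> x"]) (simp_all add: \<psi>'_def)
    qed
    show "\<psi>' x \<bottom>\<^bsub>X\<^esub> \<psi>' y \<longleftrightarrow> x \<bottom>\<^bsub>Y\<^esub> y" if "x \<in> pts Y" "y \<in> pts Y" for x y
      using perp[of "g x" "g y"] that gY g(4) by (simp add: \<psi>'_def)
  qed
  moreover have "compose (pts X) \<psi>' \<psi> = (\<lambda>x\<in>pts X. x)"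
    unfolding compose_def by (rule restrict_ext) (use g(3) fn in \<open>auto simp: \<psi>'_def\<close>)
  moreover have "compose (pts Y) \<psi> \<psi>' = (\<lambda>y\<in>pts Y. y)"
    unfolding compose_def by (rule restrict_ext) (simp add: \<psi>'_def g(4))
  ultimately show ?thesis
    unfolding oms_iso_def by blast
qed

section \<open>Points of a space as filters of clopen stable sets\<close>

context plain_oms
begin

sublocale A0: plain_oml "A0 X"
  by (rule plain_oml_A0)

definition nhds_filter :: "'x \<Rightarrow> 'x set set" where
  "nhds_filter x = {U \<in> clopen_stable X. x \<in> U}"

lemma nhds_filter_iff: "U \<in> nhds_filter x \<longleftrightarrow> U \<in> clopen_stable X \<and> x \<in> U"
  by (simp add: nhds_filter_def)

lemma nhds_filter: "x \<in> pts X \<Longrightarrow> nhds_filter x \<in> filters (A0 X)"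
  using orth_top pts_stable stable_Int
  by (intro A0.filterI) (auto simp: nhds_filter_iff le_A0)

text \<open>By \<open>separate_le\<close> the order of two points can be read off from their
  filters, so antisymmetry gives injectivity.\<close>

lemma nhds_filter_inj: "inj_on nhds_filter (pts X)"
proof (rule inj_onI)
  have *: "x \<preceq> y" if "x \<in> pts X" "y \<in> pts X" "nhds_filter x = nhds_filter y" for x y
    using separate_le[OF that(1,2)] that(3) unfolding nhds_filter_def by blast
  show "x = y" if "x \<in> pts X" "y \<in> pts X" "nhds_filter x = nhds_filter y" for x y
    using *[of x y] *[of y x] that by (simp add: frm_le_antisym)
qed

text \<open>The members of a filter \<open>F\<close> together with the complements of the non-members have the finite
  intersection property: finitely many members have a meet \<open>W = frm_up X w\<close> in \<open>F\<close>, and \<open>w\<close> avoids all non-members,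
  as a stable set containing \<open>w\<close> contains \<open>W\<close>.\<close>

lemma nhds_filter_surj:
  assumes F: "F \<in> filters (A0 X)"
  shows "\<exists>x\<in>pts X. nhds_filter x = F"
proof -
  have FC: "F \<subseteq> clopen_stable X"
    using A0.filter_subset[OF F] by auto
  have fin: "\<exists>W\<in>F. \<forall>U\<in>\<G> \<inter> F. W \<subseteq> U" if "finite \<G>" for \<G>
    using that
  proof (induction \<G>)
    case empty
    then show ?case
      using A0.filter_compl_zero[OF F] by auto
  next
    case (insert U \<G>)
    then obtain W where W: "W \<in> F" "\<forall>V\<in>\<G> \<inter> F. W \<subseteq> V"
      by blast
    show ?case
    proof (cases "U \<in> F")
      case True
      then have "U \<inter> W \<in> F"
        using A0.filter_meet[OF F _ W(1)] by simp
      then show ?thesis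
        using W(2) by (intro bexI[of _ "U \<inter> W"]) auto
    qed (use W in auto)
  qed
  let ?U = "F \<union> (\<lambda>V. pts X - V) ` (clopen_stable X - F)"
  have "\<forall>C\<in>?U. closedin (topo X) C"
    using FC by (auto simp: clopen_stable_def simp flip: topspace_eq)
  moreover have "\<Inter>\<G> \<noteq> {}" if G: "finite \<G>" "\<G> \<subseteq> ?U" for \<G>
  proof -
    obtain W where W: "W \<in> F" "\<forall>U\<in>\<G> \<inter> F. W \<subseteq> U"
      using fin[OF G(1)] by blast
    obtain w where w: "w \<in> Omg X" "W = frm_up X w"
      using stable_up W(1) FC by blast
    then have wX: "w \<in> pts X" "w \<in> W"
      using Omega_subset frm_le_refl by (auto simp: frm_up_def)
    have "w \<in> C" if C: "C \<in> \<G>" for C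
    proof (cases "C \<in> F")
      case True
      then show ?thesis
        using W C wX by blast
    next
      case False
      then obtain V where V: "V \<in> clopen_stable X" "V \<notin> F" "C = pts X - V"
        using G(2) C by blast
      have "w \<notin> V"
      proof
        assume "w \<in> V"
        then have "W \<subseteq> V"
          using stable_mono[OF V(1)] w by (auto simp: frm_up_def)
        then show False
          using V A0.filter_up[OF F W(1), of V] by (simp add: le_A0)
      qed
      then show ?thesis
        using V wX by simp
    qed
    then show ?thesis
      by blast
  qed
  ultimately have "\<Inter>?U \<noteq> {}"
    using compact unfolding compact_space_fip by (metis (no_types, lifting))
  then obtain x where x: "\<And>U. U \<in> F \<Longrightarrow> x \<in> U" "\<And>V. \<lbrakk>V \<in> clopen_stable X; V \<notin> F\<rbrakk> \<Longrightarrow> x \<in> pts X - V"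
    by blast
  \<comment> \<open>The whole space is the complement of the zero of \<open>A0 X\<close>, which
    every filter contains.\<close>
  have "pts X \<in> F"
    using A0.filter_compl_zero[OF F] by (simp add: orth_top)
  then have "x \<in> pts X"
    using x(1) by blast
  moreover have "nhds_filter x = F"
    using x FC by (auto simp: nhds_filter_def)
  ultimately show ?thesis
    by blast
qed

lemma eps_eq: "eps X = restrict nhds_filter (pts X)"
  by (simp add: eps_def nhds_filter_def fun_eq_iff)

lemma vimage_eps: "U \<in> clopen_stable X \<Longrightarrow> eps X -` hset (A0 X) U \<inter> pts X = U"
proof (rule set_eqI)
  fix x assume U: "U \<in> clopen_stable X"
  show "x \<in> eps X -` hset (A0 X) U \<inter> pts X \<longleftrightarrow> x \<in> U"
  proof (cases "x \<in> pts X")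
    case True
    then show ?thesis
      using U nhds_filter[OF True] by (simp add: eps_eq A0.hset_iff nhds_filter_iff)
  qed (use stable_subset[OF U] in blast)
qed

text \<open>Subbasic sets pull back to clopen stable sets and their complements, which are
  open.\<close>

lemma eps_continuous: "continuous_map (topo X) (topo (S0 (A0 X))) (eps X)"
  unfolding topo_S0
proof (rule continuous_on_generated_topo)
  let ?B = "hset (A0 X) ` carr (A0 X) \<union> (\<lambda>a. filters (A0 X) - hset (A0 X) a) ` carr (A0 X)"
  fix S assume "S \<in> ?B"
  then consider U where "U \<in> clopen_stable X" "S = hset (A0 X) U"
    | U where "U \<in> clopen_stable X" "S = filters (A0 X) - hset (A0 X) U"
    by auto
  then show "openin (topo X) (eps X -` S \<inter> topspace (topo X))"
  proof cases
    case 1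
    then show ?thesis
      by (simp add: topspace_eq vimage_eps) (simp add: clopen_stable_def)
  next
    case 2
    then have "eps X -` S \<inter> pts X = pts X - U"
      using vimage_eps[OF 2(1)] nhds_filter by (fastforce simp: eps_eq)
    then show ?thesis
      using 2(1) by (simp add: topspace_eq clopen_stable_def closedin_def)
  qed
next
  show "eps X ` topspace (topo X) \<subseteq>
      \<Union> (hset (A0 X) ` carr (A0 X) \<union> (\<lambda>a. filters (A0 X) - hset (A0 X) a) ` carr (A0 X))"
    using A0.topspace_S0 nhds_filter by (auto simp: topo_S0 topspace_eq eps_eq)
qed

lemma eps_iso: "eps X \<in> oms_iso X (S0 (A0 X))"
proof (rule oms_isoI)
  show "orthomodular_space X"
    by unfold_locales
  show "orthomodular_space (S0 (A0 X))"
    by (rule A0.orthomodular_space_S0)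
  show "eps X \<in> pts X \<rightarrow>\<^sub>E pts (S0 (A0 X))"
    using nhds_filter by (auto simp: eps_eq)
  have "eps X ` pts X = filters (A0 X)"
    using nhds_filter nhds_filter_surj by (force simp: eps_eq)
  moreover have "inj_on (eps X) (pts X)"
    using nhds_filter_inj by (simp add: eps_eq)
  ultimately show "homeomorphic_map (topo X) (topo (S0 (A0 X))) (eps X)"
    using eps_continuous compact A0.Hausdorff_space_S0
    by (intro continuous_imp_homeomorphic_map) (simp_all add: topspace_eq)
  \<comment> \<open>A witness for orthogonality of the two filters is a clopen stable set containing
    \<open>x\<close> whose orthocomplement contains \<open>y\<close>, which is what
    \<open>separate_perp\<close> provides.\<close>
  show "eps X x \<bottom>\<^bsub>S0 (A0 X)\<^esub> eps X y \<longleftrightarrow> x \<bottom> y" if xy: "x \<in> pts X" "y \<in> pts X" for x y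
  proof
    assume "eps X x \<bottom>\<^bsub>S0 (A0 X)\<^esub> eps X y"
    then obtain U where "x \<in> U" "y \<in> orth X U"
      using xy by (auto simp: prp_S0 eps_eq nhds_filter_iff)
    then have "y \<bottom> x"
      by (simp add: orth_def)
    then show "x \<bottom> y"
      using xy perp_sym by blast
  next
    assume "x \<bottom> y"
    then obtain U where "U \<in> clopen_stable X" "x \<in> U" "y \<in> orth X U"
      using separate_perp xy by blast
    then show "eps X x \<bottom>\<^bsub>S0 (A0 X)\<^esub> eps X y"
      using xy nhds_filter stable_orth by (auto simp: prp_S0 eps_eq nhds_filter_iff)
  qed
qed

end

text \<open>Both sides send \<open>x\<close> to the filter of clopen stable sets of \<open>Y\<close>
  that contain \<open>\<psi> x\<close>.\<close>

lemma (in oms_pair) eps_natural: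
  "compose (pts X) (S1 (A0 Y) (A0 X) (A1 X Y \<psi>)) (eps X) = compose (pts X) (eps Y) \<psi>"
  unfolding compose_def
proof (rule restrict_ext)
  fix x assume x: "x \<in> pts X"
  then have "X.nhds_filter x \<in> filters (A0 X)"
    by (rule X.nhds_filter)
  then show "S1 (A0 Y) (A0 X) (A1 X Y \<psi>) (eps X x) = eps Y (\<psi> x)"
    using x oms_homD(1)[OF hom x] preim_stable
    by (auto simp: S1_def A1_def X.eps_eq Y.eps_eq X.nhds_filter_iff Y.nhds_filter_iff)
qed


theorem theorem4p5:
  "\<comment> \<open>orthomodular lattices: identities and composites are arrows\<close>
   (\<forall>A :: 'a ortho_alg. orthomodular_lattice A \<longrightarrow> (\<lambda>a\<in>carr A. a) \<in> oml_hom A A) \<and>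
   (\<forall>(A :: 'a ortho_alg) (B :: 'b ortho_alg) (C :: 'c ortho_alg).
      orthomodular_lattice A \<longrightarrow> orthomodular_lattice B \<longrightarrow> orthomodular_lattice C \<longrightarrow>
      (\<forall>\<phi>\<in>oml_hom A B. \<forall>\<rho>\<in>oml_hom B C. compose (carr A) \<rho> \<phi> \<in> oml_hom A C)) \<and>
   \<comment> \<open>orthomodular spaces: identities and composites are arrows\<close>
   (\<forall>X :: 'x ortho_space. orthomodular_space X \<longrightarrow> (\<lambda>x\<in>pts X. x) \<in> oms_hom X X) \<and>
   (\<forall>(X :: 'x ortho_space) (Y :: 'y ortho_space) (Z :: 'z ortho_space).
      orthomodular_space X \<longrightarrow> orthomodular_space Y \<longrightarrow> orthomodular_space Z \<longrightarrow>
      (\<forall>\<psi>\<in>oms_hom X Y. \<forall>\<theta>\<in>oms_hom Y Z. compose (pts X) \<theta> \<psi> \<in> oms_hom X Z)) \<and>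
   \<comment> \<open>contravariant functor from lattices to spaces\<close>
   (\<forall>A :: 'a ortho_alg. orthomodular_lattice A \<longrightarrow>
      orthomodular_space (S0 A) \<and> S1 A A (\<lambda>a\<in>carr A. a) = (\<lambda>x\<in>pts (S0 A). x)) \<and>
   (\<forall>(A :: 'a ortho_alg) (B :: 'b ortho_alg).
      orthomodular_lattice A \<longrightarrow> orthomodular_lattice B \<longrightarrow>
      (\<forall>\<phi>\<in>oml_hom A B. S1 A B \<phi> \<in> oms_hom (S0 B) (S0 A))) \<and>
   (\<forall>(A :: 'a ortho_alg) (B :: 'b ortho_alg) (C :: 'c ortho_alg).
      orthomodular_lattice A \<longrightarrow> orthomodular_lattice B \<longrightarrow> orthomodular_lattice C \<longrightarrow>
      (\<forall>\<phi>\<in>oml_hom A B. \<forall>\<rho>\<in>oml_hom B C.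
         S1 A C (compose (carr A) \<rho> \<phi>) = compose (pts (S0 C)) (S1 A B \<phi>) (S1 B C \<rho>))) \<and>
   \<comment> \<open>contravariant functor from spaces to lattices\<close>
   (\<forall>X :: 'x ortho_space. orthomodular_space X \<longrightarrow>
      orthomodular_lattice (A0 X) \<and> A1 X X (\<lambda>x\<in>pts X. x) = (\<lambda>U\<in>carr (A0 X). U)) \<and>
   (\<forall>(X :: 'x ortho_space) (Y :: 'y ortho_space).
      orthomodular_space X \<longrightarrow> orthomodular_space Y \<longrightarrow>
      (\<forall>\<psi>\<in>oms_hom X Y. A1 X Y \<psi> \<in> oml_hom (A0 Y) (A0 X))) \<and>
   (\<forall>(X :: 'x ortho_space) (Y :: 'y ortho_space) (Z :: 'z ortho_space).
      orthomodular_space X \<longrightarrow> orthomodular_space Y \<longrightarrow> orthomodular_space Z \<longrightarrow>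
      (\<forall>\<psi>\<in>oms_hom X Y. \<forall>\<theta>\<in>oms_hom Y Z.
         A1 X Z (compose (pts X) \<theta> \<psi>) = compose (carr (A0 Z)) (A1 X Y \<psi>) (A1 Y Z \<theta>))) \<and>
   \<comment> \<open>natural isomorphism from the identity on lattices to the composite functor\<close>
   (\<forall>A :: 'a ortho_alg. orthomodular_lattice A \<longrightarrow> eta A \<in> oml_iso A (A0 (S0 A))) \<and>
   (\<forall>(A :: 'a ortho_alg) (B :: 'b ortho_alg).
      orthomodular_lattice A \<longrightarrow> orthomodular_lattice B \<longrightarrow>
      (\<forall>\<phi>\<in>oml_hom A B.
         compose (carr A) (A1 (S0 B) (S0 A) (S1 A B \<phi>)) (eta A) = compose (carr A) (eta B) \<phi>)) \<and>
   \<comment> \<open>natural isomorphism from the identity on spaces to the composite functor\<close>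
   (\<forall>X :: 'x ortho_space. orthomodular_space X \<longrightarrow> eps X \<in> oms_iso X (S0 (A0 X))) \<and>
   (\<forall>(X :: 'x ortho_space) (Y :: 'y ortho_space).
      orthomodular_space X \<longrightarrow> orthomodular_space Y \<longrightarrow>
      (\<forall>\<psi>\<in>oms_hom X Y.
         compose (pts X) (S1 (A0 Y) (A0 X) (A1 X Y \<psi>)) (eps X) = compose (pts X) (eps Y) \<psi>))"

  by (intro conjI allI impI ballI)
    (assumption | rule oml_hom_id oml_hom_compose oms_hom_id oms_hom_compose
      plain_oml.orthomodular_space_S0 plain_oml.intro S1_id oml_pair.S1_hom oml_pairI S1_compose
      plain_oms.orthomodular_lattice_A0 plain_oms.intro plain_oms.A1_id oms_pair.A1_hom oms_pairI
      A1_compose plain_oml.eta_iso oml_pair.eta_natural plain_oms.eps_iso oms_pair.eps_natural)+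

end
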